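(* With $W_H,W_L,W_J$, $A$ and $\alpha_1,\beta_1$ as in the context, let $K=\sum_{j=1}^{\lfloor N/2\rfloor}E_{2j,2j}$, $B_H=\sum_{j=1}^N2b_jE_{j,j}$, $B_L=\sum_{j=1}^N(\alpha_j+1)E_{j,j}$, $B_J=\sum_{j=1}^N(\beta_j-\alpha_j)E_{j,j}$. Then $D_H=\partial^2I+\partial\big(2A+B_H-2xI+x[A,B_H]\big)+AB_H+2K\in\mathcal D(W_H)$, $D_L=\partial^2xI+\partial\big(B_L-xI+2xA+x[A,B_L]\big)+AB_L+K\in\mathcal D(W_L)$, $D_J=\partial^2(1-x^2)I+\partial\big(2A+B_J+x([A,B_J]+2K-(\alpha_1+\beta_1+2)I)\big)+AB_J+(\alpha_1+\beta_1)K\in\mathcal D(W_J)$.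
   Context: Classical scalar weights: Hermite $w_b(x)=e^{-x^2+2bx}$ on $\mathbb R$; Laguerre $w_\alpha(x)=e^{-x}x^\alpha$ on $(0,\infty)$, $\alpha>-1$; Jacobi $w_{\alpha,\beta}(x)=(1-x)^\alpha(1+x)^\beta$ on $(-1,1)$, $\alpha,\beta>-1$. Let $N\ge2$, $A=\sum_{j=1}^{\lfloor N/2\rfloor}a_{2j-1}E_{2j-1,2j}+\sum_{j=1}^{\lfloor (N-1)/2\rfloor}a_{2j}E_{2j+1,2j}$ ($E_{s,t}$ matrix units, all $a_j\in\mathbb R\setminus\{0\}$), $T(x)=I+Ax$. $W_H=T\,\mathrm{diag}(w_{b_1},\dots,w_{b_N})\,T^*$ with $b_i$ pairwise distinct reals; $W_L=T\,\mathrm{diag}(w_{\alpha_1},\dots,w_{\alpha_N})\,T^*$ with $\alpha_i-\alpha_j\notin\mathbb Z$ for $i\ne j$; $W_J=T\,\mathrm{diag}(w_{\alpha_1,\beta_1},\dots,w_{\alpha_N,\beta_N})\,T^*$ with, for $i\ne j$, $\alpha_i-\alpha_j\notin\mathbb Z$ or $\beta_i-\beta_j\notin\mathbb Z$, and $\alpha_1+\beta_1=\alpha_j+\beta_j+1+(-1)^j$ for all $j$. $[X,Y]=XY-YX$. Differential operators $\partial^2F_2+\partial F_1+F_0$ act on the right: $P\cdot D=P''F_2+P'F_1+PF_0$. For a weight matrix $W$ with monic orthogonal polynomials $P_n$ (w.r.t. $\langle P,Q\rangle=\int PWQ^*dx$), $\mathcal D(W)$ is the algebra of differential operators with matrix polynomial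 coefficients such that $P_n\cdot D=\Lambda_n(D)P_n$ for all $n\ge0$ with constant matrices $\Lambda_n(D)$. *)

theory Defs
  imports "HOL-Analysis.Analysis" "HOL-Computational_Algebra.Polynomial" "Jordan_Normal_Form.Matrix"
begin

text \<open>Matrices are Jordan_Normal_Form matrices of size N x N (0-based internally);
  the paper's 1-based matrix unit E_{s,t} is Eu N s t below.\<close>

definition Eu :: "nat \<Rightarrow> nat \<Rightarrow> nat \<Rightarrow> real mat" where
  "Eu N s t = mat N N (\<lambda>(i,j). if i + 1 = s \<and> j + 1 = t then 1 else 0)"

fun msum :: "nat \<Rightarrow> (nat \<Rightarrow> real mat) \<Rightarrow> nat \<Rightarrow> real mat" where
  "msum N f 0 = 0\<^sub>m N N"
| "msum N f (Suc k) = msum N f k + f (Suc k)"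

definition Amat :: "nat \<Rightarrow> (nat \<Rightarrow> real) \<Rightarrow> real mat" where
  "Amat N a = msum N (\<lambda>j. a (2*j - 1) \<cdot>\<^sub>m Eu N (2*j - 1) (2*j)) (N div 2)
            + msum N (\<lambda>j. a (2*j) \<cdot>\<^sub>m Eu N (2*j + 1) (2*j)) ((N - 1) div 2)"

definition Kmat :: "nat \<Rightarrow> real mat" where
  "Kmat N = msum N (\<lambda>j. Eu N (2*j) (2*j)) (N div 2)"

definition dmat :: "nat \<Rightarrow> (nat \<Rightarrow> real) \<Rightarrow> real mat" where
  "dmat N d = msum N (\<lambda>j. d j \<cdot>\<^sub>m Eu N j j) N"

definition commut :: "real mat \<Rightarrow> real mat \<Rightarrow> real mat" where
  "commut X Y = X * Y - Y * X"

text \<open>Matrix polynomials: real poly mat. pm p M is the matrix polynomial p(x) M;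
  constant matrices are pm 1 M, and x M is pm [:0,1:] M.\<close>
definition pm :: "real poly \<Rightarrow> real mat \<Rightarrow> real poly mat" where
  "pm p M = map_mat (\<lambda>c. Polynomial.smult c p) M"

definition evalm :: "real poly mat \<Rightarrow> real \<Rightarrow> real mat" where
  "evalm P x = map_mat (\<lambda>p. poly p x) P"

definition mderiv :: "real poly mat \<Rightarrow> real poly mat" where
  "mderiv P = map_mat pderiv P"

definition coeffm :: "real poly mat \<Rightarrow> nat \<Rightarrow> real mat" where
  "coeffm P k = map_mat (\<lambda>p. coeff p k) P"

definition w_herm :: "real \<Rightarrow> real \<Rightarrow> real" where
  "w_herm b x = exp (- x\<^sup>2 + 2 * b * x)"
definition w_lag :: "real \<Rightarrow> real \<Rightarrow> real" where
  "w_lag al x = exp (- x) * x powr al"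
definition w_jac :: "real \<Rightarrow> real \<Rightarrow> real \<Rightarrow> real" where
  "w_jac al be x = (1 - x) powr al * (1 + x) powr be"

definition Tpoly :: "nat \<Rightarrow> (nat \<Rightarrow> real) \<Rightarrow> real poly mat" where
  "Tpoly N a = pm 1 (1\<^sub>m N) + pm [:0,1:] (Amat N a)"

definition Wmat :: "nat \<Rightarrow> (nat \<Rightarrow> real) \<Rightarrow> (nat \<Rightarrow> real \<Rightarrow> real) \<Rightarrow> real \<Rightarrow> real mat" where
  "Wmat N a w x = evalm (Tpoly N a) x * dmat N (\<lambda>j. w j x) * transpose_mat (evalm (Tpoly N a) x)"

definition mip :: "nat \<Rightarrow> real set \<Rightarrow> (real \<Rightarrow> real mat) \<Rightarrow> real poly mat \<Rightarrow> real poly mat \<Rightarrow> real mat" where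
  "mip N S W P Q = mat N N (\<lambda>ij. LINT x:S|lborel.
       (evalm P x * W x * transpose_mat (evalm Q x)) $$ ij)"

definition monic_OPS :: "nat \<Rightarrow> real set \<Rightarrow> (real \<Rightarrow> real mat) \<Rightarrow> (nat \<Rightarrow> real poly mat) \<Rightarrow> bool" where
  "monic_OPS N S W P \<longleftrightarrow>
     (\<forall>n. P n \<in> carrier_mat N N \<and> coeffm (P n) n = 1\<^sub>m N
          \<and> (\<forall>k>n. coeffm (P n) k = 0\<^sub>m N N)
          \<and> (\<forall>m<n. mip N S W (P n) (P m) = 0\<^sub>m N N))"

text \<open>Right action of D = d^2 F2 + d F1 + F0: P.D = P'' F2 + P' F1 + P F0\<close>
definition dop_act :: "real poly mat \<Rightarrow> real poly mat \<Rightarrow> real poly mat \<Rightarrow> real poly mat \<Rightarrow> real poly mat" where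
  "dop_act P F2 F1 F0 = mderiv (mderiv P) * F2 + mderiv P * F1 + P * F0"

definition in_DW :: "nat \<Rightarrow> real set \<Rightarrow> (real \<Rightarrow> real mat) \<Rightarrow> real poly mat \<Rightarrow> real poly mat \<Rightarrow> real poly mat \<Rightarrow> bool" where
  "in_DW N S W F2 F1 F0 \<longleftrightarrow>
     F2 \<in> carrier_mat N N \<and> F1 \<in> carrier_mat N N \<and> F0 \<in> carrier_mat N N \<and>
     (\<forall>P. monic_OPS N S W P \<longrightarrow>
        (\<forall>n. \<exists>\<Lambda> \<in> carrier_mat N N. dop_act (P n) F2 F1 F0 = pm 1 \<Lambda> * P n))"

end

theory Submission
  imports Defs "HOL-Real_Asymp.Real_Asymp"
begin

text \<open>Each of the three operators is \<open>T E T\<^sup>-\<^sup>1\<close> (acting on the right) for a diagonal operator \<open>E\<close> whose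
  entries are classical scalar operators \<open>\<sigma> \<partial>\<^sup>2 + \<tau>\<^sub>k \<partial> + c\<^sub>k\<close>. Since \<open>W = T diag(w\<^sub>k) T\<^sup>*\<close>, symmetry of \<open>D\<close>
  with respect to \<open>W\<close> reduces to symmetry of the scalar operators with respect to the \<open>w\<^sub>k\<close>, which is the
  Pearson equation and an integration by parts. A symmetric operator that does not raise degrees maps
  \<open>P\<^sub>n\<close> to a polynomial of degree at most \<open>n\<close> orthogonal to all polynomials of lower degree, hence to a
  constant multiple of \<open>P\<^sub>n\<close>.\<close>

text \<open>In 1-based numbering A has nonzero entries only in odd rows and even columns, so A^2 =
  0, T^{-1} = I - xA is again a polynomial, and conjugation by T keeps polynomial coefficients. What
  it may spoil is the degree: off the diagonal it produces
  \<open>A_lk (2 \<sigma> + x (\<tau>_k - \<tau>_l))\<close> in F1 and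
  \<open>A_lk (\<tau>_k + x (c_k - c_l))\<close> in F0, whereas D does not raise degrees if these
  have degree at most 1 and 0. The x^2 term of F1 is absent for Hermite and Laguerre, where all
  \<tau>_k have the same slope. For Jacobi 2 \<sigma> contributes -2, and the condition on
  \<alpha>_j + \<beta>_j makes the slope of \<tau>_k exceed that of \<tau>_l by exactly 2 wherever
  A_lk can be nonzero. The x term of F0 cancels when c_k - c_l is minus the slope of \<tau>_k; this
  is the origin of the factors 2, 1 and \<alpha>_1 + \<beta>_1 of K. Entry (i,j) of the matrix inner
  product involves only row i of P and row j of Q, so the argument runs on row vectors with a
  real-valued bilinear form.\<close>

section \<open>Entries of the matrices A, K and of diagonal matrices\<close>

lemma msum_carrier: "(\<And>k. f k \<in> carrier_mat N N) \<Longrightarrow> msum N f n \<in> carrier_mat N N"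
  by (induction n) auto

lemma index_msum:
  assumes "\<And>k. f k \<in> carrier_mat N N" "i < N" "j < N"
  shows "msum N f n $$ (i,j) = (\<Sum>k=1..n. f k $$ (i,j))"
proof (induction n)
  case (Suc n)
  then show ?case
    using assms(2,3) msum_carrier[of f N n] carrier_matD[OF assms(1), of "Suc n"] assms(1) by auto
qed (use assms in auto)

lemma Eu_carrier [simp]: "Eu N s t \<in> carrier_mat N N"
  by (simp add: Eu_def)

lemma index_Eu: "i < N \<Longrightarrow> j < N \<Longrightarrow> Eu N s t $$ (i,j) = (if i + 1 = s \<and> j + 1 = t then 1 else 0)"
  by (simp add: Eu_def)

lemma dim_Eu [simp]: "dim_row (Eu N s t) = N" "dim_col (Eu N s t) = N"
  by (simp_all add: Eu_def)

lemma Amat_carrier: "Amat N a \<in> carrier_mat N N"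
  unfolding Amat_def by (intro add_carrier_mat msum_carrier) auto

lemma Kmat_carrier: "Kmat N \<in> carrier_mat N N"
  unfolding Kmat_def by (intro msum_carrier) auto

lemma dmat_carrier: "dmat N d \<in> carrier_mat N N"
  unfolding dmat_def by (intro msum_carrier) auto

lemmas dim_mats [simp] = Amat_carrier[THEN carrier_matD(1)] Amat_carrier[THEN carrier_matD(2)]
  Kmat_carrier[THEN carrier_matD(1)] Kmat_carrier[THEN carrier_matD(2)]
  dmat_carrier[THEN carrier_matD(1)] dmat_carrier[THEN carrier_matD(2)]

lemma index_dmat: "i < N \<Longrightarrow> j < N \<Longrightarrow> dmat N d $$ (i,j) = (if i = j then d (Suc i) else 0)"
proof -
  assume ij: "i < N" "j < N"
  have "dmat N d $$ (i,j) = (\<Sum>k=1..N. d k * Eu N k k $$ (i,j))"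
    unfolding dmat_def using ij by (subst index_msum) auto
  also have "\<dots> = (\<Sum>k=1..N. if k = Suc i then (if i = j then d k else 0) else 0)"
    using ij by (intro sum.cong) (auto simp: index_Eu)
  finally have "dmat N d $$ (i,j) = \<dots>" .
  then show ?thesis using ij by (simp add: sum.delta)
qed

lemma index_Kmat: "i < N \<Longrightarrow> j < N \<Longrightarrow> Kmat N $$ (i,j) = (if i = j \<and> odd i then 1 else 0)"
proof -
  assume ij: "i < N" "j < N"
  have "Kmat N $$ (i,j) = (\<Sum>k=1..N div 2. Eu N (2*k) (2*k) $$ (i,j))"
    unfolding Kmat_def using ij by (subst index_msum) auto
  also have "\<dots> = (\<Sum>k=1..N div 2. if k = Suc i div 2 then (if i = j \<and> odd i then 1 else 0) else 0)"
    using ij by (intro sum.cong) (auto simp: index_Eu, presburger)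
  finally have "Kmat N $$ (i,j) = \<dots>" .
  moreover have "Suc i div 2 \<in> {1..N div 2}" if "odd i"
    using that ij by (auto elim!: oddE)
  ultimately show ?thesis by (cases "i = j \<and> odd i") (simp_all add: sum.delta del: div_Suc)
qed

text \<open>With 0-based indices the possible nonzero entries lie in even rows and odd columns. This
  zero pattern is the coordinate form of A^2 = 0 and is how nilpotency enters everywhere
  below.\<close>

lemma index_Amat_eq_0: "i < N \<Longrightarrow> j < N \<Longrightarrow> odd i \<or> even j \<Longrightarrow> Amat N a $$ (i,j) = 0"
proof -
  assume ij: "i < N" "j < N" and par: "odd i \<or> even j"
  have 1: "msum N (\<lambda>k. a (2*k - 1) \<cdot>\<^sub>m Eu N (2*k - 1) (2*k)) (N div 2) $$ (i,j) = 0"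
    using ij par by (subst index_msum) (auto simp: index_Eu intro!: sum.neutral, presburger+)
  have 2: "msum N (\<lambda>k. a (2*k) \<cdot>\<^sub>m Eu N (2*k + 1) (2*k)) ((N - 1) div 2) $$ (i,j) = 0"
    using ij par by (subst index_msum) (auto simp: index_Eu intro!: sum.neutral, presburger+)
  have "msum N (\<lambda>k. a (2*k) \<cdot>\<^sub>m Eu N (2*k + 1) (2*k)) ((N - 1) div 2) \<in> carrier_mat N N"
    by (intro msum_carrier) auto
  then show ?thesis unfolding Amat_def using ij 1 2 by auto
qed

section \<open>Degree bounds and sums for polynomial derivatives\<close>

text \<open>Differentiation pays for the degree of the factor. Constants are treated apart: there
  the truncated \<open>degree p - 1\<close> is 0 and the product bound would give 1, but the
  derivative itself vanishes.\<close>

lemma degree_pderiv_mult_le: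
  fixes p f :: "real poly"
  assumes "degree p \<le> n" "degree f \<le> 1"
  shows "degree (pderiv p * f) \<le> n"
proof (cases "degree p = 0")
  case True
  then have "pderiv p = 0" by (simp add: pderiv_eq_0_iff)
  then show ?thesis by simp
next
  case False
  then show ?thesis
    using degree_mult_le[of "pderiv p" f] assms by (simp add: degree_pderiv)
qed

lemma degree_pderiv2_mult_le:
  fixes p f :: "real poly"
  assumes "degree p \<le> n" "degree f \<le> 2"
  shows "degree (pderiv (pderiv p) * f) \<le> n"
proof (cases "degree p \<le> 1")
  case True
  then have "pderiv (pderiv p) = 0" by (simp add: pderiv_eq_0_iff degree_pderiv)
  then show ?thesis by simp
next
  case False
  then show ?thesis
    using degree_mult_le[of "pderiv (pderiv p)" f] assms by (simp add: degree_pderiv)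
qed

lemma smult_sum_right: "Polynomial.smult c (\<Sum>i\<in>I. f i) = (\<Sum>i\<in>I. Polynomial.smult c (f i))"
  by (induction I rule: infinite_finite_induct) (auto simp: smult_add_right)

lemma pderiv_sum_set: "pderiv (\<Sum>i\<in>I. f i) = (\<Sum>i\<in>I. pderiv (f i))"
  by (induction I rule: infinite_finite_induct) (auto simp: pderiv_add)

section \<open>Rows of polynomials and the bilinear form of the weight\<close>

text \<open>\<open>L k p\<close> stands for the integral of p against the scalar weight with 0-based
  index k. Linearity and definiteness on squares are kept as assumptions, so the algebra below is
  free of analysis and common to the three families.\<close>

locale triangular_form =
  fixes N :: nat and A :: "nat \<Rightarrow> nat \<Rightarrow> real" and L :: "nat \<Rightarrow> real poly \<Rightarrow> real"
  assumes A_eq_0: "\<And>i j. i < N \<Longrightarrow> j < N \<Longrightarrow> odd i \<or> even j \<Longrightarrow> A i j = 0"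
    and L_add: "\<And>k p q. k < N \<Longrightarrow> L k (p + q) = L k p + L k q"
    and L_smult: "\<And>k c p. k < N \<Longrightarrow> L k (Polynomial.smult c p) = c * L k p"
    and L_square_nonneg: "\<And>k p. k < N \<Longrightarrow> L k (p * p) \<ge> 0"
    and L_square_eq_0: "\<And>k p. k < N \<Longrightarrow> L k (p * p) = 0 \<Longrightarrow> p = 0"
begin

text \<open>Column k of the row vector r T, where T = I + xA.\<close>

definition rowT :: "(nat \<Rightarrow> real poly) \<Rightarrow> nat \<Rightarrow> real poly" where
  "rowT r k = r k + (\<Sum>l<N. [:0, A l k:] * r l)"

text \<open>For rows r of P and s of Q this is the corresponding entry of the matrix inner product,
  because P W Q^* = (P T) diag(w) (Q T)^*.\<close>

definition form :: "(nat \<Rightarrow> real poly) \<Rightarrow> (nat \<Rightarrow> real poly) \<Rightarrow> real" where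
  "form r s = (\<Sum>k<N. L k (rowT r k * rowT s k))"

lemma L_zero: "k < N \<Longrightarrow> L k 0 = 0"
  using L_smult[of k 0 0] by simp

lemma L_sum: "k < N \<Longrightarrow> L k (\<Sum>i\<in>I. f i) = (\<Sum>i\<in>I. L k (f i))"
  by (induction I rule: infinite_finite_induct) (simp_all add: L_zero L_add)

lemma form_commute: "form r s = form s r"
  by (simp add: form_def mult.commute)

lemma rowT_diff_sum:
  "rowT (\<lambda>j. s j - (\<Sum>i<N. Polynomial.smult (c i) (q i j))) k = rowT s k - (\<Sum>i<N. Polynomial.smult (c i) (rowT (q i) k))"
proof -
  have "(\<Sum>l<N. [:0, A l k:] * (\<Sum>i<N. Polynomial.smult (c i) (q i l)))
      = (\<Sum>i<N. Polynomial.smult (c i) (\<Sum>l<N. [:0, A l k:] * q i l))"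
    by (simp only: sum_distrib_left smult_sum_right mult_smult_right) (rule sum.swap)
  then show ?thesis
    by (simp only: rowT_def right_diff_distrib sum_subtractf smult_add_right sum.distrib add_diff_add)
qed

lemma form_diff_sum:
  "form r (\<lambda>j. s j - (\<Sum>i<N. Polynomial.smult (c i) (q i j))) = form r s - (\<Sum>i<N. c i * form r (q i))"
proof -
  have "L k (rowT r k * (rowT s k - (\<Sum>i<N. Polynomial.smult (c i) (rowT (q i) k))))
      = L k (rowT r k * rowT s k) - (\<Sum>i<N. c i * L k (rowT r k * rowT (q i) k))" if "k < N" for k
  proof -
    \<comment> \<open>The locale offers additivity and homogeneity but no rule for differences, so
      the minus sign is carried as the scalar -1.\<close>
    have "rowT r k * (rowT s k - (\<Sum>i<N. Polynomial.smult (c i) (rowT (q i) k)))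
        = rowT r k * rowT s k + Polynomial.smult (-1) (\<Sum>i<N. Polynomial.smult (c i) (rowT r k * rowT (q i) k))"
      by (simp add: right_diff_distrib sum_distrib_left)
    then show ?thesis using that by (simp add: L_add L_smult L_sum del: smult_minus_left)
  qed
  then have "form r (\<lambda>j. s j - (\<Sum>i<N. Polynomial.smult (c i) (q i j)))
      = (\<Sum>k<N. L k (rowT r k * rowT s k)) - (\<Sum>k<N. \<Sum>i<N. c i * L k (rowT r k * rowT (q i) k))"
    by (simp add: form_def rowT_diff_sum sum_subtractf)
  also have "(\<Sum>k<N. \<Sum>i<N. c i * L k (rowT r k * rowT (q i) k)) = (\<Sum>i<N. c i * form r (q i))"
    unfolding form_def sum_distrib_left by (rule sum.swap)
  finally show ?thesis by (simp add: form_def)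
qed

lemma form_zero_right:
  assumes "\<And>j. j < N \<Longrightarrow> s j = 0"
  shows "form r s = 0"
  using assms by (simp add: form_def rowT_def L_zero)

lemma rowT_even: "k < N \<Longrightarrow> even k \<Longrightarrow> rowT r k = r k"
  by (simp add: rowT_def A_eq_0)

text \<open>Injectivity of T without its inverse: definiteness of each \<open>L k\<close> gives r T
  = 0. In even columns T acts as the identity, so the even entries of r vanish; odd columns add only
  multiples of even entries, so the odd ones vanish too.\<close>

lemma form_self_eq_0:
  assumes "form r r = 0" "j < N"
  shows "r j = 0"
proof -
  have *: "rowT r k = 0" if "k < N" for k
  proof (rule L_square_eq_0[OF that])
    have "\<forall>k\<in>{..<N}. L k (rowT r k * rowT r k) = 0"
      using assms(1) L_square_nonneg by (subst (asm) form_def, subst (asm) sum_nonneg_eq_0_iff) auto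
    then show "L k (rowT r k * rowT r k) = 0" using that by simp
  qed
  have ev: "r l = 0" if "l < N" "even l" for l
    using *[OF that(1)] rowT_even[OF that] by simp
  have "[:0, A l j:] * r l = 0" if "l < N" for l
    using ev[OF that] A_eq_0[OF that assms(2)] by (cases "even l") auto
  then have "(\<Sum>l<N. [:0, A l j:] * r l) = 0" by (intro sum.neutral) blast
  then have "rowT r j = r j" by (simp only: rowT_def add_0_right)
  then show ?thesis using *[OF assms(2)] by simp
qed

text \<open>The leading coefficient of the m-th polynomial is the identity, so subtracting a
  combination of its rows removes the coefficients of degree m from s, and induction applies. The
  degree bound is phrased as vanishing coefficients from m on, so that m = 0 forces s = 0; a bound
  on \<open>degree\<close> could not express this.\<close>

lemma orthogonal_lower_degree:
  assumes monic: "\<And>n i j. i < N \<Longrightarrow> j < N \<Longrightarrow> coeff (p n i j) n = (if i = j then 1 else 0)"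
    and deg: "\<And>n i j k. i < N \<Longrightarrow> j < N \<Longrightarrow> k > n \<Longrightarrow> coeff (p n i j) k = 0"
    and orth: "\<And>n m i j. m < n \<Longrightarrow> i < N \<Longrightarrow> j < N \<Longrightarrow> form (p n i) (p m j) = 0"
    and "i < N" "m \<le> n" and "\<And>j k. j < N \<Longrightarrow> k \<ge> m \<Longrightarrow> coeff (s j) k = 0"
  shows "form (p n i) s = 0"
  using assms(5,6)
proof (induction m arbitrary: s)
  case 0
  then show ?case by (intro form_zero_right) (simp add: poly_eq_iff)
next
  case (Suc m)
  let ?s = "\<lambda>j. s j - (\<Sum>l<N. Polynomial.smult (coeff (s l) m) (p m l j))"
  have "coeff (?s j) k = 0" if "j < N" "k \<ge> m" for j k
  proof (cases "k = m")
    case True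
    have "(\<Sum>l<N. coeff (s l) m * coeff (p m l j) m) = (\<Sum>l<N. if l = j then coeff (s l) m else 0)"
      using that by (intro sum.cong) (auto simp: monic)
    then show ?thesis using that True by (simp add: coeff_sum)
  next
    case False
    then show ?thesis using that Suc.prems(2)[of j k] by (simp add: coeff_sum deg)
  qed
  then have "form (p n i) ?s = 0" using Suc.prems by (intro Suc.IH) auto
  moreover have "form (p n i) (p m l) = 0" if "l < N" for l
    using orth Suc.prems that \<open>i < N\<close> by auto
  ultimately show ?case by (simp add: form_diff_sum)
qed

section \<open>The differential operator on rows\<close>

definition row_act :: "real poly \<Rightarrow> (nat \<Rightarrow> nat \<Rightarrow> real poly) \<Rightarrow> (nat \<Rightarrow> nat \<Rightarrow> real poly)
    \<Rightarrow> (nat \<Rightarrow> real poly) \<Rightarrow> nat \<Rightarrow> real poly" where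
  "row_act \<sigma> F1 F0 r j = pderiv (pderiv (r j)) * \<sigma> + (\<Sum>l<N. pderiv (r l) * F1 l j) + (\<Sum>l<N. r l * F0 l j)"

text \<open>These entries of \<open>F1\<close> and \<open>F0\<close> are forced by conjugating with \<open>T\<close> the diagonal operator with
  entries \<open>\<sigma> \<partial>\<^sup>2 + \<tau> \<partial> + c\<close>.\<close>
lemma rowT_row_act:
  assumes F1: "\<And>l k. l < N \<Longrightarrow> k < N \<Longrightarrow>
      F1 l k = (if l = k then \<tau> k else 0) + Polynomial.smult (A l k) (2 * \<sigma> + [:0,1:] * (\<tau> k - \<tau> l))"
    and F0: "\<And>l k. l < N \<Longrightarrow> k < N \<Longrightarrow>
      F0 l k = (if l = k then [:c k:] else 0) + Polynomial.smult (A l k) (\<tau> k + [:0, c k - c l:])"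
    and k: "k < N"
  shows "rowT (row_act \<sigma> F1 F0 r) k
    = \<sigma> * pderiv (pderiv (rowT r k)) + \<tau> k * pderiv (rowT r k) + Polynomial.smult (c k) (rowT r k)"
proof -
  have expand: "row_act \<sigma> F1 F0 r j = \<sigma> * pderiv (pderiv (r j)) + \<tau> j * pderiv (r j) + Polynomial.smult (c j) (r j)
      + (\<Sum>l<N. Polynomial.smult (A l j) (pderiv (r l) * (2 * \<sigma> + [:0,1:] * (\<tau> j - \<tau> l))
          + r l * (\<tau> j + [:0, c j - c l:])))" if "j < N" for j
  proof -
    have "(\<Sum>l<N. pderiv (r l) * F1 l j) = (\<Sum>l<N. (if l = j then \<tau> j * pderiv (r j) else 0)
        + Polynomial.smult (A l j) (pderiv (r l) * (2 * \<sigma> + [:0,1:] * (\<tau> j - \<tau> l))))"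
      using that by (intro sum.cong) (auto simp: F1 distrib_left mult.commute)
    moreover have "(\<Sum>l<N. r l * F0 l j) = (\<Sum>l<N. (if l = j then Polynomial.smult (c j) (r j) else 0)
        + Polynomial.smult (A l j) (r l * (\<tau> j + [:0, c j - c l:])))"
      using that by (intro sum.cong) (auto simp: F0 distrib_left)
    ultimately show ?thesis
      using that by (simp add: row_act_def sum.distrib smult_add_right mult.commute)
  qed
  \<comment> \<open>Here A^2 = 0 is used: the correction sum is empty in even columns, and the
    factor x A_lk in \<open>rowT\<close> meets only entries with l even.\<close>
  have even_case: "row_act \<sigma> F1 F0 r j = \<sigma> * pderiv (pderiv (r j)) + \<tau> j * pderiv (r j) + Polynomial.smult (c j) (r j)"
    if "j < N" "even j" for j
    using that by (simp add: expand A_eq_0)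
  have "[:0, A l k:] * row_act \<sigma> F1 F0 r l = [:0, A l k:] *
      (\<sigma> * pderiv (pderiv (r l)) + \<tau> l * pderiv (r l) + Polynomial.smult (c l) (r l))" if "l < N" for l
    using that k A_eq_0[of l k] by (cases "even l") (auto simp: even_case)
  then have "rowT (row_act \<sigma> F1 F0 r) k = \<sigma> * pderiv (pderiv (r k)) + \<tau> k * pderiv (r k) + Polynomial.smult (c k) (r k)
      + (\<Sum>l<N. Polynomial.smult (A l k) (pderiv (r l) * (2 * \<sigma> + [:0,1:] * (\<tau> k - \<tau> l)) + r l * (\<tau> k + [:0, c k - c l:]))
       + [:0, A l k:] * (\<sigma> * pderiv (pderiv (r l)) + \<tau> l * pderiv (r l) + Polynomial.smult (c l) (r l)))"
    by (simp add: rowT_def expand[OF k] sum.distrib)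
  also have "\<dots> = \<sigma> * pderiv (pderiv (r k)) + \<tau> k * pderiv (r k) + Polynomial.smult (c k) (r k)
      + (\<Sum>l<N. \<sigma> * pderiv (pderiv ([:0, A l k:] * r l)) + \<tau> k * pderiv ([:0, A l k:] * r l)
          + Polynomial.smult (c k) ([:0, A l k:] * r l))"
  proof -
    \<comment> \<open>The product rule for x r_l: its second derivative supplies the 2 \<sigma>, its
      first derivative the summand \<tau>_k of F0, and the contributions of \<tau>_l and c_l
      cancel.\<close>
    have "Polynomial.smult (A l k) (pderiv (r l) * (2 * \<sigma> + [:0,1:] * (\<tau> k - \<tau> l)) + r l * (\<tau> k + [:0, c k - c l:]))
       + [:0, A l k:] * (\<sigma> * pderiv (pderiv (r l)) + \<tau> l * pderiv (r l) + Polynomial.smult (c l) (r l))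
       = \<sigma> * pderiv (pderiv ([:0, A l k:] * r l)) + \<tau> k * pderiv ([:0, A l k:] * r l)
          + Polynomial.smult (c k) ([:0, A l k:] * r l)" for l
      by (rule poly_ext) (simp add: pderiv_mult pderiv_add pderiv_smult pderiv_pCons algebra_simps)
    then show ?thesis by simp
  qed
  also have "\<dots> = \<sigma> * pderiv (pderiv (rowT r k)) + \<tau> k * pderiv (rowT r k) + Polynomial.smult (c k) (rowT r k)"
    by (simp only: rowT_def pderiv_add pderiv_sum_set sum.distrib sum_distrib_left smult_sum_right smult_add_right distrib_left add_ac)
  finally show ?thesis .
qed

lemma degree_row_act_le:
  assumes "degree \<sigma> \<le> 2" "\<And>l. l < N \<Longrightarrow> degree (F1 l j) \<le> 1" "\<And>l. l < N \<Longrightarrow> degree (F0 l j) = 0"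
    and "\<And>l. l < N \<Longrightarrow> degree (r l) \<le> n" "j < N"
  shows "degree (row_act \<sigma> F1 F0 r j) \<le> n"
  unfolding row_act_def
proof (intro degree_add_le degree_sum_le degree_pderiv2_mult_le degree_pderiv_mult_le)
  fix l assume "l \<in> {..<N}"
  then show "degree (r l * F0 l j) \<le> n"
    using degree_mult_le[of "r l" "F0 l j"] assms(3)[of l] assms(4)[of l] by simp
qed (use assms in auto)

text \<open>After multiplication by T the operator acts separately in each column, so symmetry is
  checked weight by weight. The zeroth-order term c_k is symmetric by itself, which is why
  \<open>sym\<close> mentions only the derivatives.\<close>

lemma form_row_act_commute:
  assumes "\<And>r k. k < N \<Longrightarrow> rowT (D r) k
      = \<sigma> * pderiv (pderiv (rowT r k)) + \<tau> k * pderiv (rowT r k) + Polynomial.smult (c k) (rowT r k)"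
    and sym: "\<And>k p q. k < N \<Longrightarrow> L k ((\<sigma> * pderiv (pderiv p) + \<tau> k * pderiv p) * q)
      = L k ((\<sigma> * pderiv (pderiv q) + \<tau> k * pderiv q) * p)"
  shows "form (D r) s = form r (D s)"
  unfolding form_def
proof (rule sum.cong[OF refl])
  fix k assume "k \<in> {..<N}"
  then have k: "k < N" by simp
  have *: "L k (rowT (D r) k * q) = L k ((\<sigma> * pderiv (pderiv (rowT r k)) + \<tau> k * pderiv (rowT r k)) * q)
      + c k * L k (rowT r k * q)" for r q
    by (simp add: assms(1)[OF k] L_add[OF k, symmetric] L_smult[OF k, symmetric] distrib_right)
  show "L k (rowT (D r) k * rowT s k) = L k (rowT r k * rowT (D s) k)"
    by (subst mult.commute[of _ "rowT (D s) k"], subst (1 2) *, subst sym[OF k]) (simp add: mult.commute)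
qed

text \<open>The matrix of eigenvalues can only consist of the degree-n coefficients of
  \<open>D (p n i)\<close>. The remainder R then has degree below n, hence is orthogonal to all rows
  of p_n, and form R R = form R (D p_n) = form p_n (D R) = 0 because D R has degree below n as well.
  Definiteness gives R = 0, so no norm matrix has to be inverted.\<close>

lemma eigen_rows:
  assumes monic: "\<And>n i j. i < N \<Longrightarrow> j < N \<Longrightarrow> coeff (p n i j) n = (if i = j then 1 else 0)"
    and deg: "\<And>n i j k. i < N \<Longrightarrow> j < N \<Longrightarrow> k > n \<Longrightarrow> coeff (p n i j) k = 0"
    and orth: "\<And>n m i j. m < n \<Longrightarrow> i < N \<Longrightarrow> j < N \<Longrightarrow> form (p n i) (p m j) = 0"
    and D_deg: "\<And>r n j. (\<And>l. l < N \<Longrightarrow> degree (r l) \<le> n) \<Longrightarrow> j < N \<Longrightarrow> degree (D r j) \<le> n"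
    and D_sym: "\<And>r s. form (D r) s = form r (D s)"
    and ij: "i < N" "j < N"
  shows "D (p n i) j = (\<Sum>l<N. Polynomial.smult (coeff (D (p n i) l) n) (p n l j))"
proof -
  define R where "R j = D (p n i) j - (\<Sum>l<N. Polynomial.smult (coeff (D (p n i) l) n) (p n l j))" for j
  have R_coeff: "coeff (R j) k = 0" if "j < N" "k \<ge> n" for j k
  proof (cases "k = n")
    case True
    have "(\<Sum>l<N. coeff (D (p n i) l) n * coeff (p n l j) n) = (\<Sum>l<N. if l = j then coeff (D (p n i) l) n else 0)"
      using that by (intro sum.cong) (auto simp: monic)
    then show ?thesis using that True by (simp add: R_def coeff_sum)
  next
    case False
    have "degree (D (p n i) j) \<le> n"
      using ij that by (intro D_deg degree_le) (auto simp: deg)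
    then show ?thesis using that False by (simp add: R_def coeff_sum deg coeff_eq_0)
  qed
  have low: "form (p n l) s = 0" if "l < N" "\<And>j k. j < N \<Longrightarrow> k \<ge> n \<Longrightarrow> coeff (s j) k = 0" for l s
    by (rule orthogonal_lower_degree[where m = n]) (use monic deg orth that in auto)
  \<comment> \<open>For n = 0 the truncated bound n - 1 would still allow constants, but then all
    coefficients of R vanish outright.\<close>
  have "R j = 0" if "j < N" for j
  proof (cases "n = 0")
    case True
    then show ?thesis using R_coeff[OF that] by (simp add: poly_eq_iff)
  next
    case False
    have "degree (R j) \<le> n - 1" if "j < N" for j
      using R_coeff[OF that] False by (intro degree_le) auto
    then have DR_deg: "degree (D R j) \<le> n - 1" if "j < N" for j
      using that by (rule D_deg)
    have DR: "coeff (D R j) k = 0" if "j < N" "k \<ge> n" for j k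
      using DR_deg[OF that(1)] that(2) False by (intro coeff_eq_0) linarith
    have R_fun: "R = (\<lambda>j. D (p n i) j - (\<Sum>l<N. Polynomial.smult (coeff (D (p n i) l) n) (p n l j)))"
      by (rule ext) (rule R_def)
    have "form R R = form R (D (p n i)) - (\<Sum>l<N. coeff (D (p n i) l) n * form R (p n l))"
      unfolding form_diff_sum[symmetric] R_fun[symmetric] ..
    moreover have "form R (D (p n i)) = form (p n i) (D R)"
      by (metis D_sym form_commute)
    moreover have "form (p n i) (D R) = 0"
      by (rule low) (use ij DR in auto)
    moreover have "form R (p n l) = 0" if "l < N" for l
      unfolding form_commute[of R] by (rule low) (use that R_coeff in auto)
    ultimately have "form R R = 0" by simp
    then show ?thesis using form_self_eq_0 that by blast
  qed
  then show ?thesis using ij by (simp add: R_def)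
qed

end

section \<open>Scalar weights: symmetry and definiteness\<close>

text \<open>Collects what the locale assumptions and the symmetry argument require of one scalar
  weight. Openness, nonemptiness and positivity yield definiteness; integrability of all moments
  yields linearity of the integral.\<close>

definition symmetric_weight :: "real set \<Rightarrow> (real \<Rightarrow> real) \<Rightarrow> real poly \<Rightarrow> real poly \<Rightarrow> bool" where
  "symmetric_weight S w \<sigma> \<tau> \<longleftrightarrow> open S \<and> S \<noteq> {} \<and> (\<forall>x\<in>S. w x > 0)
     \<and> (\<forall>p. set_integrable lborel S (\<lambda>x. poly p x * w x))
     \<and> (\<forall>p q. (LINT x:S|lborel. poly ((\<sigma> * pderiv (pderiv p) + \<tau> * pderiv p) * q) x * w x)
            = (LINT x:S|lborel. poly ((\<sigma> * pderiv (pderiv q) + \<tau> * pderiv q) * p) x * w x))"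

text \<open>The Pearson equation \<open>(\<sigma> w)' = \<tau> w\<close> makes \<open>(\<sigma> p'' + \<tau> p') q w - (\<sigma> q'' + \<tau> q') p w\<close> the
  derivative of \<open>\<sigma> w (p' q - p q')\<close>, which vanishes at both end points.\<close>
lemma symmetric_weight_pearson:
  fixes lo hi :: ereal and w w' :: "real \<Rightarrow> real" and \<sigma> \<tau> :: "real poly"
  assumes "lo < hi"
    and pos: "\<And>x. x \<in> einterval lo hi \<Longrightarrow> w x > 0"
    and deriv: "\<And>x. x \<in> einterval lo hi \<Longrightarrow> (w has_real_derivative w' x) (at x)"
    and pearson: "\<And>x. x \<in> einterval lo hi \<Longrightarrow> w' x * poly \<sigma> x = poly (\<tau> - pderiv \<sigma>) x * w x"
    and int: "\<And>p. set_integrable lborel (einterval lo hi) (\<lambda>x. poly p x * w x)"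
    and lim_lo: "\<And>p. (((\<lambda>x. poly p x * (poly \<sigma> x * w x)) \<circ> real_of_ereal) \<longlongrightarrow> 0) (at_right lo)"
    and lim_hi: "\<And>p. (((\<lambda>x. poly p x * (poly \<sigma> x * w x)) \<circ> real_of_ereal) \<longlongrightarrow> 0) (at_left hi)"
  shows "symmetric_weight (einterval lo hi) w \<sigma> \<tau>"
proof -
  have nonempty: "einterval lo hi \<noteq> {}"
    using ereal_dense2[OF \<open>lo < hi\<close>] by (auto simp: einterval_def)
  have "(LINT x:einterval lo hi|lborel. poly ((\<sigma> * pderiv (pderiv p) + \<tau> * pderiv p) * q) x * w x)
      = (LINT x:einterval lo hi|lborel. poly ((\<sigma> * pderiv (pderiv q) + \<tau> * pderiv q) * p) x * w x)" for p q
  proof -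
    define G where "G x = poly (pderiv p * q - p * pderiv q) x * (poly \<sigma> x * w x)" for x
    define d where "d = (\<sigma> * pderiv (pderiv p) + \<tau> * pderiv p) * q - (\<sigma> * pderiv (pderiv q) + \<tau> * pderiv q) * p"
    \<comment> \<open>G is the Wronskian of p and q times \<sigma> w, up to sign. Endpoints in the
      extended reals let one argument serve the line, the half-line and the bounded
      interval.\<close>
    have "(LBINT x=lo..hi. poly d x * w x) = 0 - 0"
    proof (rule interval_integral_FTC_integrable[where F = G])
      fix x assume "lo < ereal x" "ereal x < hi"
      then have x: "x \<in> einterval lo hi" by (simp add: einterval_def)
      have "(G has_real_derivative poly (pderiv (pderiv p * q - p * pderiv q)) x * (poly \<sigma> x * w x)
          + (poly (pderiv \<sigma>) x * w x + w' x * poly \<sigma> x) * poly (pderiv p * q - p * pderiv q) x) (at x)"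
        unfolding G_def by (intro DERIV_mult poly_DERIV deriv x)
      also have "poly (pderiv (pderiv p * q - p * pderiv q)) x * (poly \<sigma> x * w x)
          + (poly (pderiv \<sigma>) x * w x + w' x * poly \<sigma> x) * poly (pderiv p * q - p * pderiv q) x
          = poly d x * w x"
        \<comment> \<open>The Pearson equation turns \<sigma>' w + \<sigma> w' into \<tau> w; the
          products p' q' cancel in the derivative of the Wronskian.\<close>
        unfolding pearson[OF x] by (simp add: d_def pderiv_mult pderiv_diff algebra_simps)
      finally show "(G has_vector_derivative poly d x * w x) (at x)"
        by (simp add: has_real_derivative_iff_has_vector_derivative)
      show "isCont (\<lambda>x. poly d x * w x) x"
        using DERIV_isCont[OF deriv[OF x]] by (intro continuous_intros) auto
    next
      show "((G \<circ> real_of_ereal) \<longlongrightarrow> 0) (at_right lo)" "((G \<circ> real_of_ereal) \<longlongrightarrow> 0) (at_left hi)"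
        unfolding G_def by (rule lim_lo lim_hi)+
    qed (use \<open>lo < hi\<close> int in auto)
    then have "(LINT x:einterval lo hi|lborel. poly d x * w x) = 0"
      using \<open>lo < hi\<close> by (simp add: interval_lebesgue_integral_def less_imp_le)
    moreover have "(LINT x:einterval lo hi|lborel. poly d x * w x)
      = (LINT x:einterval lo hi|lborel. poly ((\<sigma> * pderiv (pderiv p) + \<tau> * pderiv p) * q) x * w x)
      - (LINT x:einterval lo hi|lborel. poly ((\<sigma> * pderiv (pderiv q) + \<tau> * pderiv q) * p) x * w x)"
      unfolding d_def poly_diff left_diff_distrib by (rule set_integral_diff(2)) (rule int)+
    ultimately show ?thesis by simp
  qed
  then show ?thesis
    using pos int nonempty unfolding symmetric_weight_def by simp
qed

text \<open>A vanishing integral of a nonnegative function makes p vanish almost everywhere on S. A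
  nonzero p has finitely many roots, so S would be a null set, which a nonempty open set is
  not.\<close>

lemma set_integral_poly_square_eq_0:
  assumes W: "symmetric_weight S w \<sigma> \<tau>" and 0: "(LINT x:S|lborel. poly (p * p) x * w x) = 0"
  shows "p = 0"
proof (rule ccontr)
  assume "p \<noteq> 0"
  have S: "open S" "S \<noteq> {}" and pos: "\<And>x. x \<in> S \<Longrightarrow> w x > 0"
    and int: "set_integrable lborel S (\<lambda>x. poly (p * p) x * w x)"
    using W unfolding symmetric_weight_def by blast+
  have "AE x in lborel. indicator S x *\<^sub>R (poly (p * p) x * w x) = 0"
  proof (subst integral_nonneg_eq_0_iff_AE[symmetric])
    show "integrable lborel (\<lambda>x. indicator S x *\<^sub>R (poly (p * p) x * w x))"
      using int by (simp add: set_integrable_def)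
    show "(LINT x|lborel. indicator S x *\<^sub>R (poly (p * p) x * w x)) = 0"
      using 0 by (simp add: set_lebesgue_integral_def)
    show "AE x in lborel. 0 \<le> indicator S x *\<^sub>R (poly (p * p) x * w x)"
      using pos by (intro AE_I2) (auto simp: indicator_def less_imp_le)
  qed
  moreover have "AE x in lborel. x \<notin> {x. poly p x = 0}"
    by (intro AE_not_in finite_imp_null_set_lborel poly_roots_finite \<open>p \<noteq> 0\<close>)
  ultimately have "AE x in lborel. x \<notin> S"
    by eventually_elim (use pos in \<open>force simp: indicator_def\<close>)
  then have "S \<in> null_sets lborel"
    using S by (subst (asm) AE_iff_null_sets[symmetric]) auto
  then have "negligible S"
    by (simp add: negligible_iff_null_sets null_sets_completionI)
  then show False using open_not_negligible S by blast
qed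

lemma set_integral_poly_square_nonneg:
  assumes "symmetric_weight S w \<sigma> \<tau>"
  shows "(LINT x:S|lborel. poly (p * p) x * w x) \<ge> 0"
  using assms unfolding symmetric_weight_def set_lebesgue_integral_def
  by (intro integral_nonneg_AE AE_I2) (auto simp: indicator_def less_imp_le)

section \<open>Tools for integrability and decay\<close>

text \<open>A nonnegative majorant is integrable as soon as it has an antiderivative with finite
  limits at both ends. Each family supplies such a pair G, g: arctan for Hermite, powers for
  Laguerre and Jacobi.\<close>

lemma set_integrable_einterval_dominated:
  fixes f g G :: "real \<Rightarrow> real" and lo hi :: ereal
  assumes "lo < hi"
    and f: "\<And>x. x \<in> einterval lo hi \<Longrightarrow> isCont f x"
    and bound: "\<And>x. x \<in> einterval lo hi \<Longrightarrow> \<bar>f x\<bar> \<le> C * g x"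
    and G: "\<And>x. x \<in> einterval lo hi \<Longrightarrow> (G has_real_derivative g x) (at x)"
    and g: "\<And>x. x \<in> einterval lo hi \<Longrightarrow> isCont g x" "\<And>x. x \<in> einterval lo hi \<Longrightarrow> 0 \<le> g x"
    and "((G \<circ> real_of_ereal) \<longlongrightarrow> A) (at_right lo)" "((G \<circ> real_of_ereal) \<longlongrightarrow> B) (at_left hi)"
  shows "set_integrable lborel (einterval lo hi) f"
proof (rule set_integrable_bound)
  have "set_integrable lborel (einterval lo hi) g"
    using assms by (intro interval_integral_FTC_nonneg(1)[where F = G]) (auto simp: einterval_def)
  then show "set_integrable lborel (einterval lo hi) (\<lambda>x. C * g x)"
    by (rule set_integrable_mult_right)
  have "continuous_on (einterval lo hi) f"
    using f by (simp add: continuous_at_imp_continuous_on)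
  then show "set_borel_measurable lborel (einterval lo hi) f"
    using borel_measurable_continuous_on_indicator[of "einterval lo hi" f]
    by (simp add: set_borel_measurable_def)
  show "AE x in lborel. x \<in> einterval lo hi \<longrightarrow> norm (f x) \<le> norm (C * g x)"
    using bound by (intro AE_I2) (smt (verit) real_norm_def)
qed

lemma tendsto_poly_exp_minus: "((\<lambda>x. poly p x * exp (- x)) \<longlongrightarrow> (0::real)) at_top"
proof -
  have "((\<lambda>x. \<Sum>i\<le>degree p. coeff p i * (x ^ i / exp x)) \<longlongrightarrow> (\<Sum>i\<le>degree p. coeff p i * 0)) at_top"
    by (intro tendsto_intros tendsto_power_div_exp_0)
  then show ?thesis
    by (simp add: poly_altdef sum_distrib_right exp_minus divide_inverse mult.assoc)
qed

lemma bounded_half_line: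
  fixes f :: "real \<Rightarrow> real"
  assumes "continuous_on {0..} f" "(f \<longlongrightarrow> 0) at_top"
  obtains C where "\<And>x. x \<ge> 0 \<Longrightarrow> \<bar>f x\<bar> \<le> C"
proof -
  have "eventually (\<lambda>x. dist (f x) 0 < 1) at_top"
    using assms(2) by (rule tendstoD) simp
  then obtain b where b: "\<And>x. x \<ge> b \<Longrightarrow> \<bar>f x\<bar> < 1"
    unfolding eventually_at_top_linorder by auto
  have "compact (f ` {0..b})"
    using assms(1) by (intro compact_continuous_image continuous_on_subset[OF assms(1)]) auto
  then have "bounded (f ` {0..b})" by (rule compact_imp_bounded)
  then obtain C where C: "\<And>x. x \<in> {0..b} \<Longrightarrow> \<bar>f x\<bar> \<le> C"
    unfolding bounded_iff by (auto simp del: atLeastAtMost_iff)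
  show thesis
  proof (rule that[of "max 1 C"])
    fix x :: real assume "x \<ge> 0"
    then show "\<bar>f x\<bar> \<le> max 1 C" using b[of x] C[of x] by (cases "x \<ge> b") auto
  qed
qed

section \<open>The Hermite weight\<close>

lemma tendsto_poly_herm_at_top: "((\<lambda>x. poly p x * w_herm b x) \<longlongrightarrow> 0) at_top"
proof -
  \<comment> \<open>The weight is split as exp(-x) times this factor; exp(-x) alone absorbs the
    polynomial.\<close>
  have "((\<lambda>x. exp (- x\<^sup>2 + 2 * b * x + x)) \<longlongrightarrow> 0) at_top" by real_asymp
  from tendsto_mult[OF tendsto_poly_exp_minus this, of p] show ?thesis
    by (simp add: w_herm_def exp_add[symmetric] mult.assoc)
qed

text \<open>Reflection replaces b by -b, so estimates at minus infinity follow from those at plus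
  infinity.\<close>

lemma herm_mirror: "poly p (- x) * w_herm b (- x) = poly (pcompose p [:0, -1:]) x * w_herm (- b) x"
  by (simp add: w_herm_def poly_pcompose)

lemma tendsto_poly_herm_at_bot: "((\<lambda>x. poly p x * w_herm b x) \<longlongrightarrow> 0) at_bot"
  unfolding filterlim_at_bot_mirror herm_mirror by (rule tendsto_poly_herm_at_top)

lemma poly_herm_bounded:
  obtains C where "\<And>x. \<bar>poly p x * w_herm b x\<bar> \<le> C"
proof -
  have cont: "continuous_on A (\<lambda>x. poly p x * w_herm b x)" for p b A
    unfolding w_herm_def by (intro continuous_intros)
  obtain C1 where C1: "\<And>x. x \<ge> 0 \<Longrightarrow> \<bar>poly p x * w_herm b x\<bar> \<le> C1"
    using bounded_half_line[OF cont tendsto_poly_herm_at_top] by blast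
  obtain C2 where C2: "\<And>x. x \<ge> 0 \<Longrightarrow> \<bar>poly (pcompose p [:0, -1:]) x * w_herm (- b) x\<bar> \<le> C2"
    using bounded_half_line[OF cont tendsto_poly_herm_at_top] by blast
  show thesis
  proof (rule that[of "max C1 C2"])
    fix x show "\<bar>poly p x * w_herm b x\<bar> \<le> max C1 C2"
      using C1[of x] C2[of "- x", folded herm_mirror] by (cases "x \<ge> 0") auto
  qed
qed

lemma symmetric_weight_herm: "symmetric_weight UNIV (w_herm b) 1 [:2 * b, -2:]"
proof -
  have "symmetric_weight (einterval (-\<infinity>) \<infinity>) (w_herm b) 1 [:2 * b, -2:]"
  proof (rule symmetric_weight_pearson)
    show "(w_herm b has_real_derivative (2 * b - 2 * x) * w_herm b x) (at x)" for x
      unfolding w_herm_def by (auto intro!: derivative_eq_intros)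
    show "set_integrable lborel (einterval (-\<infinity>) \<infinity>) (\<lambda>x. poly p x * w_herm b x)" for p
    proof -
      \<comment> \<open>The extra factor 1 + x^2 in the bounded product leaves the majorant C / (1 +
        x^2), the derivative of C arctan.\<close>
      obtain C where C: "\<And>x. \<bar>poly ([:1,0,1:] * p) x * w_herm b x\<bar> \<le> C"
        using poly_herm_bounded[of "[:1,0,1:] * p" b] by blast
      have *: "poly ([:1,0,1:] * p) x * w_herm b x = (1 + x\<^sup>2) * (poly p x * w_herm b x)" for x
        by (simp add: power2_eq_square algebra_simps)
      have b: "\<bar>poly p x * w_herm b x\<bar> \<le> C * inverse (1 + x\<^sup>2)" for x
        using C[of x] unfolding * abs_mult[of "1 + x\<^sup>2"]
        by (simp add: field_simps add_pos_nonneg)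
      show ?thesis
      proof (rule set_integrable_einterval_dominated[where G = arctan and C = C and g = "\<lambda>x. inverse (1 + x\<^sup>2)"])
        show "((arctan \<circ> real_of_ereal) \<longlongrightarrow> - (pi / 2)) (at_right (-\<infinity>))"
          unfolding ereal_tendsto_simps by (rule tendsto_arctan_at_bot)
        show "((arctan \<circ> real_of_ereal) \<longlongrightarrow> pi / 2) (at_left \<infinity>)"
          unfolding ereal_tendsto_simps by (rule tendsto_arctan_at_top)
        show "\<bar>poly p x * w_herm b x\<bar> \<le> C * inverse (1 + x\<^sup>2)" for x
          by (rule b)
        show "isCont (\<lambda>x. inverse (1 + x\<^sup>2)) x" for x :: real
          by (intro continuous_intros) (smt (verit) zero_le_power2)
      qed (auto simp: w_herm_def add_nonneg_nonneg intro!: continuous_intros DERIV_arctan)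
    qed
    show "(((\<lambda>x. poly p x * (poly 1 x * w_herm b x)) \<circ> real_of_ereal) \<longlongrightarrow> 0) (at_right (-\<infinity>))" for p
      unfolding ereal_tendsto_simps using tendsto_poly_herm_at_bot by simp
    show "(((\<lambda>x. poly p x * (poly 1 x * w_herm b x)) \<circ> real_of_ereal) \<longlongrightarrow> 0) (at_left \<infinity>)" for p
      unfolding ereal_tendsto_simps using tendsto_poly_herm_at_top by simp
  qed (auto simp: w_herm_def algebra_simps)
  then show ?thesis by (simp add: einterval_def)
qed

section \<open>The Laguerre weight\<close>

text \<open>Gives the antiderivatives of the majorants, with u = x / (1 + x) for Laguerre and u = 1
  + x, 1 - x for Jacobi. The bound c > -1 keeps c + 1 positive, so these also have finite limits
  where u tends to 0.\<close>

lemma has_real_derivative_powr_antideriv: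
  fixes u :: "real \<Rightarrow> real"
  assumes "(u has_real_derivative m) (at x)" "u x > 0" "c > -1"
  shows "((\<lambda>x. u x powr (c + 1) / (c + 1)) has_real_derivative u x powr c * m) (at x)"
proof -
  have "((\<lambda>x. u x powr (c + 1) / (c + 1)) has_real_derivative
      (c + 1) * u x powr (c + 1 - of_nat 1) * m / (c + 1)) (at x)"
    by (intro DERIV_cdivide DERIV_fun_powr assms)
  then show ?thesis using assms by simp
qed

lemma symmetric_weight_lag:
  assumes "al > -1"
  shows "symmetric_weight {0<..} (w_lag al) [:0, 1:] [:al + 1, -1:]"
proof -
  have S: "einterval 0 \<infinity> = {0<..}" by (auto simp: einterval_def zero_ereal_def)
  \<comment> \<open>A natural exponent above \<alpha> + 2 lets real powers be bounded by
    polynomials, to which the decay of polynomial times exp(-x) applies.\<close>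
  obtain m :: nat where m: "al + 2 \<le> real m" using real_arch_simple by blast
  have "symmetric_weight (einterval 0 \<infinity>) (w_lag al) [:0, 1:] [:al + 1, -1:]"
  proof (rule symmetric_weight_pearson)
    fix x :: real assume "x \<in> einterval 0 \<infinity>"
    then have x: "x > 0" by (simp add: S)
    then show "w_lag al x > 0" by (simp add: w_lag_def)
    show "(w_lag al has_real_derivative (al / x - 1) * w_lag al x) (at x)"
      unfolding w_lag_def using x
      by (auto intro!: derivative_eq_intros simp: powr_diff field_simps)
    show "(al / x - 1) * w_lag al x * poly [:0, 1:] x = poly ([:al + 1, -1:] - pderiv [:0, 1:]) x * w_lag al x"
      using x by (simp add: pderiv_pCons field_simps)
  next
    fix p :: "real poly"
    have "continuous_on {0..} (\<lambda>x. poly ([:1,1:] ^ m * p) x * exp (- x))"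
      by (intro continuous_intros)
    then obtain C where C: "\<And>x. x \<ge> 0 \<Longrightarrow> \<bar>poly ([:1,1:] ^ m * p) x * exp (- x)\<bar> \<le> C"
      using bounded_half_line[OF _ tendsto_poly_exp_minus] by blast
    \<comment> \<open>\<open>g\<close> behaves like \<open>x\<^sup>\<alpha>\<close> at \<open>0\<close> and like \<open>x\<^sup>-\<^sup>2\<close> at infinity, and has an explicit antiderivative.\<close>
    define g where "g x = (x / (1 + x)) powr al * inverse ((1 + x)\<^sup>2)" for x :: real
    define G where "G x = (x / (1 + x)) powr (al + 1) / (al + 1)" for x :: real
    show "set_integrable lborel (einterval 0 \<infinity>) (\<lambda>x. poly p x * w_lag al x)"
    proof (rule set_integrable_einterval_dominated[where G = G and g = g])
      fix x :: real assume "x \<in> einterval 0 \<infinity>"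
      then have x: "x > 0" by (simp add: S)
      show "isCont (\<lambda>x. poly p x * w_lag al x) x"
        unfolding w_lag_def using x by (intro continuous_intros) auto
      show "isCont g x"
        unfolding g_def using x by (intro continuous_intros) auto
      show "0 \<le> g x" by (simp add: g_def)
      show "(G has_real_derivative g x) (at x)"
        unfolding G_def g_def
      proof (rule has_real_derivative_powr_antideriv)
        show "((\<lambda>x. x / (1 + x)) has_real_derivative inverse ((1 + x)\<^sup>2)) (at x)"
          using x by (auto intro!: derivative_eq_intros simp: power2_eq_square field_simps)
      qed (use x assms in auto)
      have "w_lag al x = exp (- x) * (1 + x) powr (al + 2) * g x"
        using x by (simp add: w_lag_def g_def powr_divide powr_add field_simps)
      also have "\<dots> \<le> exp (- x) * (1 + x) ^ m * g x"
      proof -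
        have "(1 + x) powr (al + 2) \<le> (1 + x) powr real m"
          using x m by (intro powr_mono) auto
        also have "\<dots> = (1 + x) ^ m" using x by (simp add: powr_realpow)
        finally show ?thesis using \<open>0 \<le> g x\<close> by (intro mult_right_mono mult_left_mono) auto
      qed
      finally have "\<bar>poly p x * w_lag al x\<bar> \<le> \<bar>poly p x\<bar> * (exp (- x) * (1 + x) ^ m * g x)"
        using x by (auto simp: abs_mult w_lag_def intro!: mult_left_mono)
      also have "\<dots> = \<bar>poly ([:1,1:] ^ m * p) x * exp (- x)\<bar> * g x"
        using x by (simp add: abs_mult poly_power)
      also have "\<dots> \<le> C * g x"
        using C[of x] x \<open>0 \<le> g x\<close> by (intro mult_right_mono) auto
      finally show "\<bar>poly p x * w_lag al x\<bar> \<le> C * g x" .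
    next
      have "(G \<longlongrightarrow> (0 / (1 + 0)) powr (al + 1) / (al + 1)) (at_right 0)"
        unfolding G_def using assms
        by (intro tendsto_intros tendsto_powr') (auto simp: eventually_at_right_less intro!: eventually_mono[OF eventually_at_right_less])
      then show "((G \<circ> real_of_ereal) \<longlongrightarrow> (0 / (1 + 0)) powr (al + 1) / (al + 1)) (at_right 0)"
        unfolding zero_ereal_def ereal_tendsto_simps .
      have "((\<lambda>x::real. x / (1 + x)) \<longlongrightarrow> 1) at_top" by real_asymp
      then have "(G \<longlongrightarrow> 1 powr (al + 1) / (al + 1)) at_top"
        unfolding G_def using assms by (intro tendsto_intros) auto
      then show "((G \<circ> real_of_ereal) \<longlongrightarrow> 1 powr (al + 1) / (al + 1)) (at_left \<infinity>)"
        unfolding ereal_tendsto_simps .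
    qed simp
    \<comment> \<open>Here \<sigma> w = x^{\<alpha>+1} exp(-x) has a positive exponent, so the
      boundary term vanishes at 0 even when w itself is unbounded there.\<close>
    have "((\<lambda>x. poly p x * (exp (- x) * x powr (al + 1))) \<longlongrightarrow> poly p 0 * (exp (- 0) * 0 powr (al + 1))) (at_right 0)"
      using assms by (intro tendsto_intros tendsto_powr') (auto intro!: eventually_mono[OF eventually_at_right_less])
    moreover have "\<forall>\<^sub>F x in at_right 0. poly p x * (exp (- x) * x powr (al + 1))
        = poly p x * (poly [:0, 1:] x * w_lag al x)"
      by (auto simp: w_lag_def powr_add intro!: eventually_mono[OF eventually_at_right_less])
    ultimately have "((\<lambda>x. poly p x * (poly [:0, 1:] x * w_lag al x))
        \<longlongrightarrow> poly p 0 * (exp (- 0) * 0 powr (al + 1))) (at_right 0)"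
      by (rule Lim_transform_eventually)
    then have "((\<lambda>x. poly p x * (poly [:0, 1:] x * w_lag al x)) \<longlongrightarrow> 0) (at_right 0)" by simp
    then show "(((\<lambda>x. poly p x * (poly [:0, 1:] x * w_lag al x)) \<circ> real_of_ereal) \<longlongrightarrow> 0) (at_right 0)"
      unfolding zero_ereal_def ereal_tendsto_simps .
    \<comment> \<open>For x \<ge> 1 the power x^\<alpha> is at most x^m, which leaves a polynomial
      times exp(-x).\<close>
    have "((\<lambda>x. poly p x * (poly [:0, 1:] x * w_lag al x)) \<longlongrightarrow> 0) at_top"
    proof (rule Lim_null_comparison)
      show "((\<lambda>x. \<bar>poly (monom 1 (Suc m) * p) x * exp (- x)\<bar>) \<longlongrightarrow> 0) at_top"
        using tendsto_poly_exp_minus by (rule tendsto_rabs_zero)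
      show "\<forall>\<^sub>F x in at_top. norm (poly p x * (poly [:0, 1:] x * w_lag al x))
          \<le> \<bar>poly (monom 1 (Suc m) * p) x * exp (- x)\<bar>"
        using eventually_ge_at_top[of 1]
      proof eventually_elim
        case (elim x)
        have "x powr al \<le> x powr real m" using elim m by (intro powr_mono) auto
        also have "\<dots> = x ^ m" using elim by (simp add: powr_realpow)
        finally have "\<bar>poly p x\<bar> * (x * (exp (- x) * x powr al)) \<le> \<bar>poly p x\<bar> * (x * (exp (- x) * x ^ m))"
          using elim by (intro mult_left_mono) auto
        then show ?case using elim by (simp add: w_lag_def abs_mult poly_monom mult_ac)
      qed
    qed
    then show "(((\<lambda>x. poly p x * (poly [:0, 1:] x * w_lag al x)) \<circ> real_of_ereal) \<longlongrightarrow> 0) (at_left \<infinity>)"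
      unfolding ereal_tendsto_simps .
  qed simp
  then show ?thesis by (simp add: S)
qed

section \<open>The Jacobi weight\<close>

lemma powr_le_max_one:
  fixes y :: real
  assumes "1 \<le> y" "y \<le> 2"
  shows "y powr c \<le> max 1 (2 powr c)"
proof (cases "c \<ge> 0")
  case True
  then have "y powr c \<le> 2 powr c" using assms by (intro powr_mono2) auto
  then show ?thesis by simp
next
  case False
  then have "y powr c \<le> y powr 0" using assms by (intro powr_mono) auto
  then show ?thesis using assms by simp
qed

text \<open>On each half of the interval one of the factors 1 + x, 1 - x lies between 1 and 2, so
  its power is at most C whatever the sign of the exponent. Passing from the product to a sum of two
  powers gives a majorant with an elementary antiderivative.\<close>

lemma w_jac_le:
  fixes x al be :: real
  assumes "-1 < x" "x < 1"
  defines "C \<equiv> max (max 1 (2 powr al)) (max 1 (2 powr be))"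
  shows "w_jac al be x \<le> C * ((1 - x) powr al + (1 + x) powr be)"
proof (cases "x \<ge> 0")
  case True
  then have "w_jac al be x \<le> (1 - x) powr al * C"
    unfolding w_jac_def C_def using assms powr_le_max_one[of "1 + x" be] by (intro mult_left_mono) auto
  also have "\<dots> \<le> C * ((1 - x) powr al + (1 + x) powr be)"
    by (simp add: C_def distrib_left mult.commute[of "(1 - x) powr al"])
  finally show ?thesis .
next
  case False
  then have "w_jac al be x \<le> C * (1 + x) powr be"
    unfolding w_jac_def C_def using assms powr_le_max_one[of "1 - x" al] by (intro mult_right_mono) auto
  also have "\<dots> \<le> C * ((1 - x) powr al + (1 + x) powr be)"
    by (simp add: C_def distrib_left)
  finally show ?thesis .
qed

lemma symmetric_weight_jac:
  assumes al: "al > -1" and be: "be > -1"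
  shows "symmetric_weight {-1<..<1} (w_jac al be) [:1, 0, -1:] [:be - al, - (al + be + 2):]"
proof -
  have S: "einterval (ereal (-1)) (ereal 1) = {-1<..<1}" by (auto simp: einterval_def)
  have "symmetric_weight (einterval (ereal (-1)) (ereal 1)) (w_jac al be) [:1, 0, -1:] [:be - al, - (al + be + 2):]"
  proof (rule symmetric_weight_pearson)
    fix x :: real assume "x \<in> einterval (ereal (-1)) (ereal 1)"
    then have x: "-1 < x" "x < 1" by (simp_all add: S)
    then show "w_jac al be x > 0" by (simp add: w_jac_def)
    show "(w_jac al be has_real_derivative (be / (1 + x) - al / (1 - x)) * w_jac al be x) (at x)"
      unfolding w_jac_def using x
      by (auto intro!: derivative_eq_intros simp: powr_diff field_simps)
    \<comment> \<open>Since \<sigma> = (1 - x)(1 + x), each denominator of the logarithmic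
      derivative of w is cancelled by one factor.\<close>
    have "(be / (1 + x) - al / (1 - x)) * poly [:1, 0, -1:] x
        = be / (1 + x) * (1 + x) * (1 - x) - al / (1 - x) * (1 - x) * (1 + x)"
      by (simp only: left_diff_distrib) (simp add: algebra_simps)
    also have "\<dots> = be * (1 - x) - al * (1 + x)" using x by simp
    finally have "(be / (1 + x) - al / (1 - x)) * poly [:1, 0, -1:] x * w_jac al be x
        = (be * (1 - x) - al * (1 + x)) * w_jac al be x" by (rule arg_cong)
    then show "(be / (1 + x) - al / (1 - x)) * w_jac al be x * poly [:1, 0, -1:] x
        = poly ([:be - al, - (al + be + 2):] - pderiv [:1, 0, -1:]) x * w_jac al be x"
      by (simp only: mult.assoc mult.commute[of "w_jac al be x"]) (simp add: pderiv_pCons algebra_simps)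
  next
    fix p :: "real poly"
    have "compact (poly p ` {-1..1})"
      by (intro compact_continuous_image continuous_intros) auto
    then have "bounded (poly p ` {-1..1})" by (rule compact_imp_bounded)
    then obtain M where M: "\<And>x. x \<in> {-1..1} \<Longrightarrow> \<bar>poly p x\<bar> \<le> M"
      unfolding bounded_iff by (auto simp del: atLeastAtMost_iff)
    define C where "C = max (max 1 (2 powr al)) (max 1 (2 powr be))"
    define g where "g x = (1 - x) powr al + (1 + x) powr be" for x :: real
    define G where "G x = (1 + x) powr (be + 1) / (be + 1) - (1 - x) powr (al + 1) / (al + 1)" for x :: real
    show "set_integrable lborel (einterval (ereal (-1)) (ereal 1)) (\<lambda>x. poly p x * w_jac al be x)"
    proof (rule set_integrable_einterval_dominated[where G = G and g = g])
      fix x :: real assume "x \<in> einterval (ereal (-1)) (ereal 1)"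
      then have x: "-1 < x" "x < 1" by (simp_all add: S)
      show "isCont (\<lambda>x. poly p x * w_jac al be x) x"
        unfolding w_jac_def using x by (intro continuous_intros) auto
      show "isCont g x"
        unfolding g_def using x by (intro continuous_intros) auto
      show "0 \<le> g x" by (simp add: g_def)
      show "(G has_real_derivative g x) (at x)"
      proof -
        have "(G has_real_derivative (1 + x) powr be * 1 - (1 - x) powr al * (-1)) (at x)"
          unfolding G_def using x assms
          by (intro DERIV_diff has_real_derivative_powr_antideriv) (auto intro!: derivative_eq_intros)
        then show ?thesis by (simp add: g_def add.commute)
      qed
      have "\<bar>poly p x * w_jac al be x\<bar> = \<bar>poly p x\<bar> * w_jac al be x"
        by (simp add: abs_mult w_jac_def)
      also have "\<dots> \<le> M * (C * g x)"
        unfolding C_def g_def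
        using M[of x] w_jac_le[OF x] M[of 0] x by (intro mult_mono) (auto simp: w_jac_def)
      finally show "\<bar>poly p x * w_jac al be x\<bar> \<le> M * C * g x" by (simp add: mult.assoc)
    next
      have "(G \<longlongrightarrow> (1 + (-1)) powr (be + 1) / (be + 1) - (1 - (-1)) powr (al + 1) / (al + 1)) (at_right (-1))"
        unfolding G_def using assms
        by (intro tendsto_intros tendsto_powr') (auto intro!: eventually_mono[OF eventually_at_right_less])
      then show "((G \<circ> real_of_ereal) \<longlongrightarrow> (1 + (-1)) powr (be + 1) / (be + 1) - (1 - (-1)) powr (al + 1) / (al + 1)) (at_right (ereal (-1)))"
        unfolding ereal_tendsto_simps .
      have "(G \<longlongrightarrow> (1 + 1) powr (be + 1) / (be + 1) - (1 - 1) powr (al + 1) / (al + 1)) (at_left 1)"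
        unfolding G_def using assms
        by (intro tendsto_intros tendsto_powr') (auto intro!: eventually_mono[OF eventually_at_left_real[of 0 1]])
      then show "((G \<circ> real_of_ereal) \<longlongrightarrow> (1 + 1) powr (be + 1) / (be + 1) - (1 - 1) powr (al + 1) / (al + 1)) (at_left (ereal 1))"
        unfolding ereal_tendsto_simps .
    qed simp
    \<comment> \<open>Multiplying by \<sigma> raises both exponents by 1. They become positive, so
      the boundary terms tend to 0 at both ends.\<close>
    have eq: "poly p x * ((1 - x) powr (al + 1) * (1 + x) powr (be + 1)) = poly p x * (poly [:1, 0, -1:] x * w_jac al be x)"
      if "x \<in> {-1<..<1}" for x
      using that by (simp add: w_jac_def powr_add algebra_simps)
    have "((\<lambda>x. poly p x * ((1 - x) powr (al + 1) * (1 + x) powr (be + 1)))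
        \<longlongrightarrow> poly p (-1) * ((1 - (-1)) powr (al + 1) * (1 + (-1)) powr (be + 1))) (at_right (-1))"
      using assms by (intro tendsto_intros tendsto_powr') (auto intro!: eventually_mono[OF eventually_at_right_less])
    then have "((\<lambda>x. poly p x * (poly [:1, 0, -1:] x * w_jac al be x))
        \<longlongrightarrow> poly p (-1) * ((1 - (-1)) powr (al + 1) * (1 + (-1)) powr (be + 1))) (at_right (-1))"
      by (rule Lim_transform_eventually) (rule eventually_mono[OF eventually_at_right_real eq], auto)
    then have "((\<lambda>x. poly p x * (poly [:1, 0, -1:] x * w_jac al be x)) \<longlongrightarrow> 0) (at_right (-1))" by simp
    then show "(((\<lambda>x. poly p x * (poly [:1, 0, -1:] x * w_jac al be x)) \<circ> real_of_ereal) \<longlongrightarrow> 0) (at_right (ereal (-1)))"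
      unfolding ereal_tendsto_simps .
    have "((\<lambda>x. poly p x * ((1 - x) powr (al + 1) * (1 + x) powr (be + 1)))
        \<longlongrightarrow> poly p 1 * ((1 - 1) powr (al + 1) * (1 + 1) powr (be + 1))) (at_left 1)"
      using assms by (intro tendsto_intros tendsto_powr') (auto intro!: eventually_mono[OF eventually_at_left_real[of 0 1]])
    then have "((\<lambda>x. poly p x * (poly [:1, 0, -1:] x * w_jac al be x))
        \<longlongrightarrow> poly p 1 * ((1 - 1) powr (al + 1) * (1 + 1) powr (be + 1))) (at_left 1)"
      by (rule Lim_transform_eventually) (rule eventually_mono[OF eventually_at_left_real eq], auto)
    then have "((\<lambda>x. poly p x * (poly [:1, 0, -1:] x * w_jac al be x)) \<longlongrightarrow> 0) (at_left 1)" by simp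
    then show "(((\<lambda>x. poly p x * (poly [:1, 0, -1:] x * w_jac al be x)) \<circ> real_of_ereal) \<longlongrightarrow> 0) (at_left (ereal 1))"
      unfolding ereal_tendsto_simps .
  qed simp
  then show ?thesis by (simp add: S)
qed

section \<open>From matrix operators to rows\<close>

lemma index_mult_mat_sum:
  assumes "A \<in> carrier_mat n m" "B \<in> carrier_mat m k" "i < n" "j < k"
  shows "(A * B) $$ (i,j) = (\<Sum>l<m. A $$ (i,l) * B $$ (l,j))"
  using assms by (simp add: scalar_prod_def atLeast0LessThan)

lemma evalm_carrier: "P \<in> carrier_mat n m \<Longrightarrow> evalm P x \<in> carrier_mat n m"
  by (simp add: evalm_def)

lemma Tpoly_carrier: "Tpoly N a \<in> carrier_mat N N"
  by (simp add: Tpoly_def pm_def carrier_matI)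

lemma index_Tpoly:
  "l < N \<Longrightarrow> k < N \<Longrightarrow> Tpoly N a $$ (l,k) = (if l = k then 1 else 0) + [:0, Amat N a $$ (l,k):]"
  by (simp add: Tpoly_def pm_def one_pCons)

lemma index_mult_dmat:
  assumes "M \<in> carrier_mat N N" "i < N" "j < N"
  shows "(M * dmat N d) $$ (i,j) = M $$ (i,j) * d (Suc j)"
proof -
  have "(M * dmat N d) $$ (i,j) = (\<Sum>l<N. M $$ (i,l) * dmat N d $$ (l,j))"
    using assms(1) dmat_carrier assms(2,3) by (rule index_mult_mat_sum)
  also have "\<dots> = (\<Sum>l<N. if l = j then M $$ (i,l) * d (Suc l) else 0)"
    using assms by (intro sum.cong) (auto simp: index_dmat)
  finally show ?thesis using assms by simp
qed

lemma index_dmat_mult: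
  assumes "M \<in> carrier_mat N N" "i < N" "j < N"
  shows "(dmat N d * M) $$ (i,j) = d (Suc i) * M $$ (i,j)"
proof -
  have "(dmat N d * M) $$ (i,j) = (\<Sum>l<N. dmat N d $$ (i,l) * M $$ (l,j))"
    using dmat_carrier assms by (rule index_mult_mat_sum)
  also have "\<dots> = (\<Sum>l<N. if l = i then d (Suc l) * M $$ (l,j) else 0)"
    using assms by (intro sum.cong) (auto simp: index_dmat)
  finally show ?thesis using assms by simp
qed

lemma index_mult_dmat_transpose:
  assumes "M \<in> carrier_mat N N" "M' \<in> carrier_mat N N" "i < N" "j < N"
  shows "(M * dmat N d * transpose_mat M') $$ (i,j) = (\<Sum>k<N. M $$ (i,k) * d (Suc k) * M' $$ (j,k))"
proof -
  have "(M * dmat N d * transpose_mat M') $$ (i,j) = (\<Sum>k<N. (M * dmat N d) $$ (i,k) * transpose_mat M' $$ (k,j))"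
    using assms dmat_carrier[of N d] by (intro index_mult_mat_sum[of _ N N _ N]) auto
  also have "\<dots> = (\<Sum>k<N. M $$ (i,k) * d (Suc k) * M' $$ (j,k))"
    using assms by (intro sum.cong) (auto simp: index_mult_dmat simp del: index_mult_mat(1))
  finally show ?thesis .
qed

text \<open>The interface for the three families: \<open>F1\<close> and \<open>F0\<close> say that D
  is the conjugate of the diagonal operator given by \<sigma>, \<tau> and c, while
  \<open>F1_deg\<close> and \<open>F0_deg\<close> demand the degree cancellations, which is where
  the particular parameters enter. Weights are numbered from 1 and matrix entries from 0, hence
  \<open>w (Suc k)\<close>.\<close>

lemma in_DW_of_diagonal:
  fixes N :: nat and a :: "nat \<Rightarrow> real" and w :: "nat \<Rightarrow> real \<Rightarrow> real" and c :: "nat \<Rightarrow> real"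
  assumes W: "\<And>k. k < N \<Longrightarrow> symmetric_weight S (w (Suc k)) \<sigma> (\<tau> k)"
    and \<sigma>: "degree \<sigma> \<le> 2"
    and F1c: "F1 \<in> carrier_mat N N" and F0c: "F0 \<in> carrier_mat N N"
    and F1_deg: "\<And>l k. l < N \<Longrightarrow> k < N \<Longrightarrow> degree (F1 $$ (l,k)) \<le> 1"
    and F0_deg: "\<And>l k. l < N \<Longrightarrow> k < N \<Longrightarrow> degree (F0 $$ (l,k)) = 0"
    and F1: "\<And>l k. l < N \<Longrightarrow> k < N \<Longrightarrow> F1 $$ (l,k) = (if l = k then \<tau> k else 0)
        + Polynomial.smult (Amat N a $$ (l,k)) (2 * \<sigma> + [:0,1:] * (\<tau> k - \<tau> l))"
    and F0: "\<And>l k. l < N \<Longrightarrow> k < N \<Longrightarrow> F0 $$ (l,k) = (if l = k then [:c k:] else 0)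
        + Polynomial.smult (Amat N a $$ (l,k)) (\<tau> k + [:0, c k - c l:])"
  shows "in_DW N S (Wmat N a w) (pm \<sigma> (1\<^sub>m N)) F1 F0"
proof -
  define L where "L k p = (LINT x:S|lborel. poly p x * w (Suc k) x)" for k p
  have int: "set_integrable lborel S (\<lambda>x. poly p x * w (Suc k) x)" if "k < N" for k p
    using W[OF that] unfolding symmetric_weight_def by blast
  interpret triangular_form N "\<lambda>i j. Amat N a $$ (i,j)" L
  proof
    fix i j assume "i < N" "j < N" "odd i \<or> even j"
    then show "Amat N a $$ (i,j) = 0" by (rule index_Amat_eq_0)
  next
    fix k p q assume k: "k < N"
    show "L k (p + q) = L k p + L k q"
      unfolding L_def poly_add distrib_right by (rule set_integral_add(2)) (rule int[OF k])+
  next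
    fix k c p assume "k < N"
    show "L k (Polynomial.smult c p) = c * L k p"
      unfolding L_def poly_smult mult.assoc by (rule set_integral_mult_right)
  next
    fix k p assume k: "k < N"
    show "L k (p * p) \<ge> 0"
      unfolding L_def by (rule set_integral_poly_square_nonneg[OF W[OF k]])
    show "p = 0" if "L k (p * p) = 0"
      using that unfolding L_def by (rule set_integral_poly_square_eq_0[OF W[OF k]])
  qed
  have evalT: "(evalm P x * evalm (Tpoly N a) x) $$ (i,k) = poly (rowT (\<lambda>l. P $$ (i,l)) k) x"
    if "P \<in> carrier_mat N N" "i < N" "k < N" for P i k x
  proof -
    have "(evalm P x * evalm (Tpoly N a) x) $$ (i,k) = (\<Sum>l<N. evalm P x $$ (i,l) * evalm (Tpoly N a) x $$ (l,k))"
      using evalm_carrier[OF that(1)] evalm_carrier[OF Tpoly_carrier] that(2,3) by (rule index_mult_mat_sum)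
    also have "\<dots> = (\<Sum>l<N. (if l = k then poly (P $$ (i,l)) x else 0) + poly ([:0, Amat N a $$ (l,k):] * P $$ (i,l)) x)"
      using that carrier_matD[OF Tpoly_carrier[of N a]]
      by (intro sum.cong) (auto simp: evalm_def index_Tpoly algebra_simps)
    also have "\<dots> = poly (rowT (\<lambda>l. P $$ (i,l)) k) x"
      using that by (simp add: sum.distrib rowT_def poly_sum)
    finally show ?thesis .
  qed
  have mip: "mip N S (Wmat N a w) P Q $$ (i,j) = form (\<lambda>l. P $$ (i,l)) (\<lambda>l. Q $$ (j,l))"
    if P: "P \<in> carrier_mat N N" and Q: "Q \<in> carrier_mat N N" and ij: "i < N" "j < N" for P Q i j
  proof -
    have "(evalm P x * Wmat N a w x * transpose_mat (evalm Q x)) $$ (i,j)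
        = (\<Sum>k<N. poly (rowT (\<lambda>l. P $$ (i,l)) k * rowT (\<lambda>l. Q $$ (j,l)) k) x * w (Suc k) x)" for x
    proof -
      let ?P = "evalm P x" and ?Q = "evalm Q x" and ?T = "evalm (Tpoly N a) x" and ?D = "dmat N (\<lambda>j. w j x)"
      note c = evalm_carrier[OF P, of x] evalm_carrier[OF Q, of x] evalm_carrier[OF Tpoly_carrier, of N a x]
        dmat_carrier[of N "\<lambda>j. w j x"]
      \<comment> \<open>T and its transpose move from the weight into the two polynomials, leaving a
        diagonal matrix in the middle.\<close>
      have "?P * Wmat N a w x * transpose_mat ?Q = ?P * ?T * ?D * transpose_mat (?Q * ?T)"
        unfolding Wmat_def using c by (simp add: transpose_mult[of _ N N _ N] assoc_mult_mat[of _ N N _ N _ N])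
      moreover have "(?P * ?T * ?D * transpose_mat (?Q * ?T)) $$ (i,j)
          = (\<Sum>k<N. (?P * ?T) $$ (i,k) * w (Suc k) x * (?Q * ?T) $$ (j,k))"
        using c ij by (intro index_mult_dmat_transpose) auto
      ultimately show ?thesis
        using P Q ij by (simp add: evalT mult_ac)
    qed
    then have "mip N S (Wmat N a w) P Q $$ (i,j)
        = (LINT x:S|lborel. \<Sum>k<N. poly (rowT (\<lambda>l. P $$ (i,l)) k * rowT (\<lambda>l. Q $$ (j,l)) k) x * w (Suc k) x)"
      using ij by (simp add: mip_def)
    also have "\<dots> = form (\<lambda>l. P $$ (i,l)) (\<lambda>l. Q $$ (j,l))"
      \<comment> \<open>Exchanging sum and integral relies on the integrability of every single
        summand, provided by \<open>int\<close>.\<close>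
      unfolding form_def L_def set_lebesgue_integral_def scaleR_sum_right
      using int unfolding set_integrable_def by (intro Bochner_Integration.integral_sum) blast
    finally show ?thesis .
  qed
  let ?D = "row_act \<sigma> (\<lambda>l k. F1 $$ (l,k)) (\<lambda>l k. F0 $$ (l,k))"
  have act: "dop_act P (pm \<sigma> (1\<^sub>m N)) F1 F0 $$ (i,j) = ?D (\<lambda>l. P $$ (i,l)) j"
    if P: "P \<in> carrier_mat N N" and ij: "i < N" "j < N" for P i j
  proof -
    have c: "mderiv P \<in> carrier_mat N N" "mderiv (mderiv P) \<in> carrier_mat N N" "pm \<sigma> (1\<^sub>m N) \<in> carrier_mat N N"
      using P by (auto simp: mderiv_def pm_def)
    have "(mderiv (mderiv P) * pm \<sigma> (1\<^sub>m N)) $$ (i,j) = (\<Sum>l<N. mderiv (mderiv P) $$ (i,l) * pm \<sigma> (1\<^sub>m N) $$ (l,j))"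
      using c(2,3) ij by (rule index_mult_mat_sum)
    also have "\<dots> = (\<Sum>l<N. if l = j then pderiv (pderiv (P $$ (i,l))) * \<sigma> else 0)"
      using P ij by (intro sum.cong) (auto simp: mderiv_def pm_def)
    finally have "(mderiv (mderiv P) * pm \<sigma> (1\<^sub>m N)) $$ (i,j) = pderiv (pderiv (P $$ (i,j))) * \<sigma>"
      using ij by simp
    moreover have "(mderiv P * F1) $$ (i,j) = (\<Sum>l<N. pderiv (P $$ (i,l)) * F1 $$ (l,j))"
      using c P F1c ij by (subst index_mult_mat_sum[of _ N N _ N]) (auto simp: mderiv_def)
    moreover have "(P * F0) $$ (i,j) = (\<Sum>l<N. P $$ (i,l) * F0 $$ (l,j))"
      using P F0c ij by (rule index_mult_mat_sum)
    ultimately show ?thesis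
      using c P F1c F0c ij by (simp add: dop_act_def row_act_def del: index_mult_mat(1))
  qed
  have "\<exists>\<Lambda>\<in>carrier_mat N N. dop_act (P n) (pm \<sigma> (1\<^sub>m N)) F1 F0 = pm 1 \<Lambda> * P n"
    if OPS: "monic_OPS N S (Wmat N a w) P" for P n
  proof
    define p where "p n i l = P n $$ (i,l)" for n i l
    have P: "P n \<in> carrier_mat N N" for n using OPS by (simp add: monic_OPS_def)
    have coeffm: "coeffm (P n) k $$ (i,j) = coeff (p n i j) k" if "i < N" "j < N" for n k i j
      using P[of n] that by (simp add: coeffm_def p_def)
    \<comment> \<open>Comparing coefficients of degree n on both sides, with P_n monic, dictates
      this choice.\<close>
    let ?\<Lambda> = "mat N N (\<lambda>(i,l). coeff (?D (p n i) l) n)"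
    show "?\<Lambda> \<in> carrier_mat N N" by simp
    have eig: "?D (p n i) j = (\<Sum>l<N. Polynomial.smult (coeff (?D (p n i) l) n) (p n l j))" if "i < N" "j < N" for i j
    proof (rule eigen_rows)
      fix n i j assume ij: "i < N" "j < N"
      show "coeff (p n i j) n = (if i = j then 1 else 0)"
        using OPS ij by (simp add: monic_OPS_def coeffm[symmetric])
      show "coeff (p n i j) k = 0" if "k > n" for k
        using OPS ij that by (simp add: monic_OPS_def coeffm[symmetric])
      show "form (p n i) (p m j) = 0" if "m < n" for m
      proof -
        have "form (p n i) (p m j) = mip N S (Wmat N a w) (P n) (P m) $$ (i,j)"
          using mip[OF P P ij] by (simp add: p_def[abs_def])
        then show ?thesis using OPS ij that by (simp add: monic_OPS_def)
      qed
    next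
      fix r :: "nat \<Rightarrow> real poly" and n j assume "\<And>l. l < N \<Longrightarrow> degree (r l) \<le> n" "j < N"
      then show "degree (?D r j) \<le> n"
        using \<sigma> F1_deg F0_deg by (intro degree_row_act_le) auto
    next
      fix r s
      show "form (?D r) s = form r (?D s)"
      proof (rule form_row_act_commute)
        fix r k assume "k < N"
        then show "rowT (?D r) k = \<sigma> * pderiv (pderiv (rowT r k)) + \<tau> k * pderiv (rowT r k)
            + Polynomial.smult (c k) (rowT r k)"
          using F1 F0 by (intro rowT_row_act) auto
      next
        fix k p q assume "k < N"
        then show "L k ((\<sigma> * pderiv (pderiv p) + \<tau> k * pderiv p) * q)
            = L k ((\<sigma> * pderiv (pderiv q) + \<tau> k * pderiv q) * p)"
          using W[of k] unfolding symmetric_weight_def L_def by blast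
      qed
    qed (use that in auto)
    show "dop_act (P n) (pm \<sigma> (1\<^sub>m N)) F1 F0 = pm 1 ?\<Lambda> * P n"
    proof (rule eq_matI)
      have pm: "pm 1 ?\<Lambda> \<in> carrier_mat N N" by (simp add: pm_def)
      show dims: "dim_row (dop_act (P n) (pm \<sigma> (1\<^sub>m N)) F1 F0) = dim_row (pm 1 ?\<Lambda> * P n)"
        "dim_col (dop_act (P n) (pm \<sigma> (1\<^sub>m N)) F1 F0) = dim_col (pm 1 ?\<Lambda> * P n)"
        using P[of n] F0c pm by (simp_all add: dop_act_def)
      fix i j assume "i < dim_row (pm 1 ?\<Lambda> * P n)" "j < dim_col (pm 1 ?\<Lambda> * P n)"
      then have ij: "i < N" "j < N" using P[of n] pm by auto
      have "(pm 1 ?\<Lambda> * P n) $$ (i,j) = (\<Sum>l<N. pm 1 ?\<Lambda> $$ (i,l) * P n $$ (l,j))"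
        using pm P ij by (rule index_mult_mat_sum)
      also have "\<dots> = (\<Sum>l<N. Polynomial.smult (coeff (?D (p n i) l) n) (p n l j))"
        using ij by (intro sum.cong) (auto simp: pm_def p_def)
      also have "\<dots> = ?D (p n i) j" using eig[OF ij] by simp
      also have "\<dots> = dop_act (P n) (pm \<sigma> (1\<^sub>m N)) F1 F0 $$ (i,j)"
        using act[OF P ij] by (simp add: p_def[abs_def])
      finally show "dop_act (P n) (pm \<sigma> (1\<^sub>m N)) F1 F0 $$ (i,j) = (pm 1 ?\<Lambda> * P n) $$ (i,j)" ..
    qed
  qed
  then show ?thesis
    using F1c F0c by (simp add: in_DW_def pm_def)
qed

section \<open>The Hermite, Laguerre and Jacobi operators\<close>

text \<open>The factor d_k - d_l is the difference of the constant parts of \<tau>_k and \<tau>_l,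
  so the term x[A,B] is their share of A_lk x (\<tau>_k - \<tau>_l).\<close>

lemma index_commut_dmat:
  assumes "M \<in> carrier_mat N N" "i < N" "j < N"
  shows "commut M (dmat N d) $$ (i,j) = M $$ (i,j) * (d (Suc j) - d (Suc i))"
  using assms dmat_carrier[of N d] index_mult_dmat[OF assms, of d] index_dmat_mult[OF assms, of d]
  by (simp add: commut_def algebra_simps del: index_mult_mat(1))

lemma commut_carrier: "X \<in> carrier_mat N N \<Longrightarrow> Y \<in> carrier_mat N N \<Longrightarrow> commut X Y \<in> carrier_mat N N"
  by (auto simp: commut_def)

text \<open>With \<sigma> = 1 the term 2 \<sigma> A is the constant 2A. All slopes of \<tau>_k are
  -2, so c jumps by 2 from even to odd k, which produces 2K.\<close>

lemma in_DW_herm: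
  shows "in_DW N UNIV (Wmat N a (\<lambda>j. w_herm (b j)))
    (pm 1 (1\<^sub>m N))
    (pm 1 (2 \<cdot>\<^sub>m Amat N a) + pm 1 (dmat N (\<lambda>j. 2 * b j)) - pm [:0,1:] (2 \<cdot>\<^sub>m 1\<^sub>m N) + pm [:0,1:] (commut (Amat N a) (dmat N (\<lambda>j. 2 * b j))))
    (pm 1 (Amat N a * dmat N (\<lambda>j. 2 * b j) + 2 \<cdot>\<^sub>m Kmat N))"
proof -
  let ?A = "Amat N a" and ?B = "dmat N (\<lambda>j. 2 * b j)"
  let ?F1 = "pm 1 (2 \<cdot>\<^sub>m Amat N a) + pm 1 (dmat N (\<lambda>j. 2 * b j)) - pm [:0,1:] (2 \<cdot>\<^sub>m 1\<^sub>m N) + pm [:0,1:] (commut (Amat N a) (dmat N (\<lambda>j. 2 * b j)))"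
  let ?F0 = "pm 1 (Amat N a * dmat N (\<lambda>j. 2 * b j) + 2 \<cdot>\<^sub>m Kmat N)"
  have comm: "commut ?A ?B \<in> carrier_mat N N"
    by (intro commut_carrier Amat_carrier dmat_carrier)
  have prod: "?A * ?B \<in> carrier_mat N N"
    using Amat_carrier dmat_carrier by (rule mult_carrier_mat)
  have F1: "?F1 $$ (l,k) = [:2 * ?A $$ (l,k) + (if l = k then 2 * b (Suc k) else 0), ?A $$ (l,k) * (2 * b (Suc k) - 2 * b (Suc l)) - (if l = k then 2 else 0):]" if "l < N" "k < N" for l k
    using that carrier_matD[OF comm] by (simp add: pm_def index_dmat index_Kmat index_commut_dmat[OF Amat_carrier] one_pCons algebra_simps)
  have F0: "?F0 $$ (l,k) = [:?A $$ (l,k) * (2 * b (Suc k)) + (if l = k \<and> odd k then 2 else 0):]" if "l < N" "k < N" for l k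
    using that carrier_matD[OF prod]
    by (auto simp: pm_def index_Kmat index_mult_dmat[OF Amat_carrier] one_pCons algebra_simps simp del: index_mult_mat(1))
  show ?thesis
  proof (rule in_DW_of_diagonal[where \<tau> = "\<lambda>k. [:2 * b (Suc k), -2:]" and c = "\<lambda>k. if odd k then 2 else 0"])
    fix k assume k: "k < N"
    show "symmetric_weight UNIV (w_herm (b (Suc k))) 1 ([:2 * b (Suc k), -2:])"
      by (rule symmetric_weight_herm)
  next
    show "?F1 \<in> carrier_mat N N" "?F0 \<in> carrier_mat N N"
      using carrier_matD[OF comm] by (auto simp: pm_def intro!: carrier_matI)
  next
    fix l k assume lk: "l < N" "k < N"
    show "degree (?F1 $$ (l,k)) \<le> 1" unfolding F1[OF lk] by simp
    show "degree (?F0 $$ (l,k)) = 0" unfolding F0[OF lk] by simp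
    \<comment> \<open>Where A_lk is nonzero, l is even and k is odd: the entry is off the diagonal
      and c_k - c_l takes its full value 2, cancelling the slope -2 of \<tau>_k.\<close>
    have par: "?A $$ (l,k) = 0 \<or> (even l \<and> odd k)"
      using index_Amat_eq_0[OF lk] by blast
    show "?F1 $$ (l,k) = (if l = k then [:2 * b (Suc k), -2:] else 0)
        + Polynomial.smult (?A $$ (l,k)) (2 * 1 + [:0,1:] * ([:2 * b (Suc k), -2:] - [:2 * b (Suc l), -2:]))"
      using par unfolding F1[OF lk] by (auto simp: numeral_poly one_pCons algebra_simps)
    show "?F0 $$ (l,k) = (if l = k then [:if odd k then 2 else 0:] else 0)
        + Polynomial.smult (?A $$ (l,k)) ([:2 * b (Suc k), -2:] + [:0, (if odd k then 2 else 0) - (if odd l then 2 else 0):])"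
      using par unfolding F0[OF lk] by (auto simp: algebra_simps)
  qed simp
qed

text \<open>With \<sigma> = x the term 2 \<sigma> A becomes 2xA, still of degree 1. The common slope
  is -1, hence the jump of c by 1 and the summand K.\<close>

lemma in_DW_lag:
  assumes "\<forall>i\<in>{1..N}. al i > -1"
  shows "in_DW N {0<..} (Wmat N a (\<lambda>j. w_lag (al j)))
    (pm [:0,1:] (1\<^sub>m N))
    (pm 1 (dmat N (\<lambda>j. al j + 1)) - pm [:0,1:] (1\<^sub>m N) + pm [:0,1:] (2 \<cdot>\<^sub>m Amat N a) + pm [:0,1:] (commut (Amat N a) (dmat N (\<lambda>j. al j + 1))))
    (pm 1 (Amat N a * dmat N (\<lambda>j. al j + 1) + Kmat N))"
proof -
  let ?A = "Amat N a" and ?B = "dmat N (\<lambda>j. al j + 1)"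
  let ?F1 = "pm 1 (dmat N (\<lambda>j. al j + 1)) - pm [:0,1:] (1\<^sub>m N) + pm [:0,1:] (2 \<cdot>\<^sub>m Amat N a) + pm [:0,1:] (commut (Amat N a) (dmat N (\<lambda>j. al j + 1)))"
  let ?F0 = "pm 1 (Amat N a * dmat N (\<lambda>j. al j + 1) + Kmat N)"
  have comm: "commut ?A ?B \<in> carrier_mat N N"
    by (intro commut_carrier Amat_carrier dmat_carrier)
  have prod: "?A * ?B \<in> carrier_mat N N"
    using Amat_carrier dmat_carrier by (rule mult_carrier_mat)
  have F1: "?F1 $$ (l,k) = [:if l = k then al (Suc k) + 1 else 0, 2 * ?A $$ (l,k) + ?A $$ (l,k) * (al (Suc k) - al (Suc l)) - (if l = k then 1 else 0):]" if "l < N" "k < N" for l k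
    using that carrier_matD[OF comm] by (simp add: pm_def index_dmat index_Kmat index_commut_dmat[OF Amat_carrier] one_pCons algebra_simps)
  have F0: "?F0 $$ (l,k) = [:?A $$ (l,k) * (al (Suc k) + 1) + (if l = k \<and> odd k then 1 else 0):]" if "l < N" "k < N" for l k
    using that carrier_matD[OF prod]
    by (auto simp: pm_def index_Kmat index_mult_dmat[OF Amat_carrier] one_pCons algebra_simps simp del: index_mult_mat(1))
  show ?thesis
  proof (rule in_DW_of_diagonal[where \<tau> = "\<lambda>k. [:al (Suc k) + 1, -1:]" and c = "\<lambda>k. if odd k then 1 else 0"])
    fix k assume k: "k < N"
    show "symmetric_weight {0<..} (w_lag (al (Suc k))) [:0,1:] ([:al (Suc k) + 1, -1:])"
      using assms k by (intro symmetric_weight_lag) auto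
  next
    show "?F1 \<in> carrier_mat N N" "?F0 \<in> carrier_mat N N"
      using carrier_matD[OF comm] by (auto simp: pm_def intro!: carrier_matI)
  next
    fix l k assume lk: "l < N" "k < N"
    show "degree (?F1 $$ (l,k)) \<le> 1" unfolding F1[OF lk] by simp
    show "degree (?F0 $$ (l,k)) = 0" unfolding F0[OF lk] by simp
    have par: "?A $$ (l,k) = 0 \<or> (even l \<and> odd k)"
      using index_Amat_eq_0[OF lk] by blast
    show "?F1 $$ (l,k) = (if l = k then [:al (Suc k) + 1, -1:] else 0)
        + Polynomial.smult (?A $$ (l,k)) (2 * [:0,1:] + [:0,1:] * ([:al (Suc k) + 1, -1:] - [:al (Suc l) + 1, -1:]))"
      using par unfolding F1[OF lk] by (auto simp: numeral_poly one_pCons algebra_simps)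
    show "?F0 $$ (l,k) = (if l = k then [:if odd k then 1 else 0:] else 0)
        + Polynomial.smult (?A $$ (l,k)) ([:al (Suc k) + 1, -1:] + [:0, (if odd k then 1 else 0) - (if odd l then 1 else 0):])"
      using par unfolding F0[OF lk] by (auto simp: algebra_simps)
  qed simp
qed

text \<open>Now 2 \<sigma> A contains -2 x^2 A. For odd k the slope of \<tau>_k is larger by 2 than
  for even k, which cancels this term and also gives the summand 2xK of F1. That slope is
  -(\<alpha>_1 + \<beta>_1), hence the factor of K in F0.\<close>

lemma in_DW_jac:
  assumes pos: "\<forall>i\<in>{1..N}. al i > -1 \<and> be i > -1"
    and sum: "\<forall>j\<in>{1..N}. al 1 + be 1 = al j + be j + 1 + (-1) ^ j"
  shows "in_DW N {-1<..<1} (Wmat N a (\<lambda>j. w_jac (al j) (be j)))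
    (pm [:1,0,-1:] (1\<^sub>m N))
    (pm 1 (2 \<cdot>\<^sub>m Amat N a) + pm 1 (dmat N (\<lambda>j. be j - al j)) + pm [:0,1:] (commut (Amat N a) (dmat N (\<lambda>j. be j - al j)) + 2 \<cdot>\<^sub>m Kmat N - (al 1 + be 1 + 2) \<cdot>\<^sub>m 1\<^sub>m N))
    (pm 1 (Amat N a * dmat N (\<lambda>j. be j - al j) + (al 1 + be 1) \<cdot>\<^sub>m Kmat N))"
proof -
  let ?A = "Amat N a" and ?B = "dmat N (\<lambda>j. be j - al j)"
  let ?F1 = "pm 1 (2 \<cdot>\<^sub>m Amat N a) + pm 1 (dmat N (\<lambda>j. be j - al j)) + pm [:0,1:] (commut (Amat N a) (dmat N (\<lambda>j. be j - al j)) + 2 \<cdot>\<^sub>m Kmat N - (al 1 + be 1 + 2) \<cdot>\<^sub>m 1\<^sub>m N)"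
  let ?F0 = "pm 1 (Amat N a * dmat N (\<lambda>j. be j - al j) + (al 1 + be 1) \<cdot>\<^sub>m Kmat N)"
  have comm: "commut ?A ?B \<in> carrier_mat N N"
    by (intro commut_carrier Amat_carrier dmat_carrier)
  have prod: "?A * ?B \<in> carrier_mat N N"
    using Amat_carrier dmat_carrier by (rule mult_carrier_mat)
  have F1: "?F1 $$ (l,k) = [:2 * ?A $$ (l,k) + (if l = k then be (Suc k) - al (Suc k) else 0), ?A $$ (l,k) * (be (Suc k) - al (Suc k) - (be (Suc l) - al (Suc l))) + (if l = k then - (al 1 + be 1 + 2) + (if odd k then 2 else 0) else 0):]" if "l < N" "k < N" for l k
    using that carrier_matD[OF comm] by (simp add: pm_def index_dmat index_Kmat index_commut_dmat[OF Amat_carrier] one_pCons algebra_simps)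
  have F0: "?F0 $$ (l,k) = [:?A $$ (l,k) * (be (Suc k) - al (Suc k)) + (if l = k \<and> odd k then al 1 + be 1 else 0):]" if "l < N" "k < N" for l k
    using that carrier_matD[OF prod]
    by (auto simp: pm_def index_Kmat index_mult_dmat[OF Amat_carrier] one_pCons algebra_simps simp del: index_mult_mat(1))
  show ?thesis
  proof (rule in_DW_of_diagonal[where \<tau> = "\<lambda>k. [:be (Suc k) - al (Suc k), - (al 1 + be 1 + 2) + (if odd k then 2 else 0):]" and c = "\<lambda>k. if odd k then al 1 + be 1 else 0"])
    fix k assume k: "k < N"
    show "symmetric_weight {-1<..<1} (w_jac (al (Suc k)) (be (Suc k))) [:1,0,-1:] ([:be (Suc k) - al (Suc k), - (al 1 + be 1 + 2) + (if odd k then 2 else 0):])"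
      (is "symmetric_weight _ _ _ ?\<tau>")
    proof -
      \<comment> \<open>With j = k + 1 the hypothesis says that \<alpha>_j + \<beta>_j equals
        \<alpha>_1 + \<beta>_1 for even k and is smaller by 2 for odd k.\<close>
      have "?\<tau> = [:be (Suc k) - al (Suc k), - (al (Suc k) + be (Suc k) + 2):]"
        using sum k by (cases "odd k") (auto dest!: bspec[of _ _ "Suc k"])
      moreover have "symmetric_weight {-1<..<1} (w_jac (al (Suc k)) (be (Suc k))) [:1,0,-1:] \<dots>"
        using pos k by (intro symmetric_weight_jac) auto
      ultimately show ?thesis by (simp only:)
    qed
  next
    show "?F1 \<in> carrier_mat N N" "?F0 \<in> carrier_mat N N"
      using carrier_matD[OF comm] by (auto simp: pm_def intro!: carrier_matI)
  next
    fix l k assume lk: "l < N" "k < N"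
    show "degree (?F1 $$ (l,k)) \<le> 1" unfolding F1[OF lk] by simp
    show "degree (?F0 $$ (l,k)) = 0" unfolding F0[OF lk] by simp
    have par: "?A $$ (l,k) = 0 \<or> (even l \<and> odd k)"
      using index_Amat_eq_0[OF lk] by blast
    show "?F1 $$ (l,k) = (if l = k then [:be (Suc k) - al (Suc k), - (al 1 + be 1 + 2) + (if odd k then 2 else 0):] else 0)
        + Polynomial.smult (?A $$ (l,k)) (2 * [:1,0,-1:] + [:0,1:] * ([:be (Suc k) - al (Suc k), - (al 1 + be 1 + 2) + (if odd k then 2 else 0):] - [:be (Suc l) - al (Suc l), - (al 1 + be 1 + 2) + (if odd l then 2 else 0):]))"
      using par unfolding F1[OF lk] by (auto simp: numeral_poly one_pCons algebra_simps)
    show "?F0 $$ (l,k) = (if l = k then [:if odd k then al 1 + be 1 else 0:] else 0)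
        + Polynomial.smult (?A $$ (l,k)) ([:be (Suc k) - al (Suc k), - (al 1 + be 1 + 2) + (if odd k then 2 else 0):] + [:0, (if odd k then al 1 + be 1 else 0) - (if odd l then al 1 + be 1 else 0):])"
      using par unfolding F0[OF lk] by (auto simp: algebra_simps)
  qed simp
qed

theorem theorem4p2:
  fixes N :: nat and a b alL alJ beJ :: "nat \<Rightarrow> real"
  assumes N2: "N \<ge> 2"
    and a_nz: "\<forall>j\<in>{1..N-1}. a j \<noteq> 0"
  shows
   "((\<forall>i\<in>{1..N}. \<forall>j\<in>{1..N}. i \<noteq> j \<longrightarrow> b i \<noteq> b j) \<longrightarrow>
      in_DW N UNIV (Wmat N a (\<lambda>j. w_herm (b j)))
        (pm 1 (1\<^sub>m N))
        (pm 1 (2 \<cdot>\<^sub>m Amat N a) + pm 1 (dmat N (\<lambda>j. 2 * b j))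
           - pm [:0,1:] (2 \<cdot>\<^sub>m 1\<^sub>m N) + pm [:0,1:] (commut (Amat N a) (dmat N (\<lambda>j. 2 * b j))))
        (pm 1 (Amat N a * dmat N (\<lambda>j. 2 * b j) + 2 \<cdot>\<^sub>m Kmat N)))
  \<and> ((\<forall>i\<in>{1..N}. alL i > -1) \<and>
      (\<forall>i\<in>{1..N}. \<forall>j\<in>{1..N}. i \<noteq> j \<longrightarrow> alL i - alL j \<notin> \<int>) \<longrightarrow>
      in_DW N {0<..} (Wmat N a (\<lambda>j. w_lag (alL j)))
        (pm [:0,1:] (1\<^sub>m N))
        (pm 1 (dmat N (\<lambda>j. alL j + 1)) - pm [:0,1:] (1\<^sub>m N)
           + pm [:0,1:] (2 \<cdot>\<^sub>m Amat N a) + pm [:0,1:] (commut (Amat N a) (dmat N (\<lambda>j. alL j + 1))))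
        (pm 1 (Amat N a * dmat N (\<lambda>j. alL j + 1) + Kmat N)))
  \<and> ((\<forall>i\<in>{1..N}. alJ i > -1 \<and> beJ i > -1) \<and>
      (\<forall>i\<in>{1..N}. \<forall>j\<in>{1..N}. i \<noteq> j \<longrightarrow> alJ i - alJ j \<notin> \<int> \<or> beJ i - beJ j \<notin> \<int>) \<and>
      (\<forall>j\<in>{1..N}. alJ 1 + beJ 1 = alJ j + beJ j + 1 + (-1) ^ j) \<longrightarrow>
      in_DW N {-1<..<1} (Wmat N a (\<lambda>j. w_jac (alJ j) (beJ j)))
        (pm [:1,0,-1:] (1\<^sub>m N))
        (pm 1 (2 \<cdot>\<^sub>m Amat N a) + pm 1 (dmat N (\<lambda>j. beJ j - alJ j))
           + pm [:0,1:] (commut (Amat N a) (dmat N (\<lambda>j. beJ j - alJ j)) + 2 \<cdot>\<^sub>m Kmat N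
                          - (alJ 1 + beJ 1 + 2) \<cdot>\<^sub>m 1\<^sub>m N))
        (pm 1 (Amat N a * dmat N (\<lambda>j. beJ j - alJ j) + (alJ 1 + beJ 1) \<cdot>\<^sub>m Kmat N)))"
  using in_DW_herm[of N a b] in_DW_lag[of N alL a] in_DW_jac[of N alJ beJ a] by blast

end
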